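(* With infinite matrices indexed by positive integers $i$ (rows) and $j$ (columns), one has $$\Bigl[\,\bigl|L_i(\mathcal{C}^m_j)\bigr|\,\Bigr]=(Sc)^mS\quad\text{for every integer } m\ge 0,\qquad \Bigl[\,\bigl|L_i(\mathcal{S}^m_j)\bigr|\,\Bigr]=(Sc)^m\quad\text{for every integer } m\ge 1,$$ where $c=[c(j,i)]$ and $S=[S(j,i)]$.
   Context: $[a_{ij}]$ denotes the infinite matrix whose entry in the $i$-th row and $j$-th column is $a_{ij}$, where $i,j$ run over all positive integers. $c(j,i)$ is the unsigned Stirling number of the first kind (the number of ways to partition a $j$-element set into $i$ cycles) and $S(j,i)$ is the Stirling number of the second kind (the number of set partitions of a $j$-element set into $i$ blocks). Thus the $(i,j)$ entry of $c$ is $c(j,i)$ and that of $S$ is $S(j,i)$; both matrices are upper triangular, so their products are well defined (finite sums entrywise); a zeroth power is the identity matrix. Arrangements in $\mathbb{R}^n$: $\mathcal{C}_n^m=\{\{x_i-x_j=a\}: 1\le i<j\le n,\ a\in\mathbb{Z},\ -m\le a\le m\}$ for $m\ge 0$ (extended Catalan), and $\mathcal{S}^m_n=\{\{x_i-x_j=a\}:1\le i<j\le n,\ a\in\mathbb{Z},\ 1-m\le a\le m\}$ for $m\ge 1$ (extended Shi). A flat of an arrangement $\mathcal{A}$ is a nonempty intersection of hyperplanes of $\mathcal{A}$ (including the ambient space as the empty intersection); $L_k(\mathcal{A})$ is the set of flats of dimension $k$. *)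

theory Defs
  imports
    "HOL-Analysis.Finite_Function_Topology"
    "HOL-Combinatorics.Stirling"
begin

text \<open>
  The dimension n has to range over all positive integers inside one formula, so R^n is not
  a type here: it is the subspace of the real vector space of finitely supported functions
  \<^typ>\<open>nat \<Rightarrow>\<^sub>0 real\<close> consisting of the vectors supported on the coordinates 1, ..., n. The
  coordinate \<open>x\<^sub>i\<close> is \<open>lookup x i\<close>.
\<close>

definition Rspace :: "nat \<Rightarrow> (nat \<Rightarrow>\<^sub>0 real) set" where
  "Rspace n = {x. Poly_Mapping.keys x \<subseteq> {1..n}}"

definition hyperplane :: "nat \<Rightarrow> nat \<Rightarrow> nat \<Rightarrow> int \<Rightarrow> (nat \<Rightarrow>\<^sub>0 real) set" where
  "hyperplane n i j a =
     {x \<in> Rspace n. Poly_Mapping.lookup x i - Poly_Mapping.lookup x j = real_of_int a}"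

definition ext_catalan :: "nat \<Rightarrow> nat \<Rightarrow> (nat \<Rightarrow>\<^sub>0 real) set set" where
  "ext_catalan m n =
     {hyperplane n i j a | i j a. 1 \<le> i \<and> i < j \<and> j \<le> n \<and> - int m \<le> a \<and> a \<le> int m}"

definition ext_shi :: "nat \<Rightarrow> nat \<Rightarrow> (nat \<Rightarrow>\<^sub>0 real) set set" where
  "ext_shi m n =
     {hyperplane n i j a | i j a. 1 \<le> i \<and> i < j \<and> j \<le> n \<and> 1 - int m \<le> a \<and> a \<le> int m}"

text \<open>Intersecting with \<open>Rspace n\<close> makes the empty intersection the ambient space.\<close>

definition flats :: "nat \<Rightarrow> (nat \<Rightarrow>\<^sub>0 real) set set \<Rightarrow> (nat \<Rightarrow>\<^sub>0 real) set set" where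
  "flats n \<A> = {F. F \<noteq> {} \<and> (\<exists>\<B> \<subseteq> \<A>. F = Rspace n \<inter> \<Inter>\<B>)}"

text \<open>
  The dimension of a nonempty affine subspace is the linear dimension of its direction space
  (\<open>aff_dim\<close> is only available on Euclidean spaces).
\<close>

definition flat_dim :: "'a::real_vector set \<Rightarrow> nat" where
  "flat_dim F = dim {x - y | x y. x \<in> F \<and> y \<in> F}"

definition flats_of_dim ::
    "nat \<Rightarrow> (nat \<Rightarrow>\<^sub>0 real) set set \<Rightarrow> nat \<Rightarrow> (nat \<Rightarrow>\<^sub>0 real) set set" where
  "flats_of_dim n \<A> k = {F \<in> flats n \<A>. flat_dim F = k}"

text \<open>
  Infinite matrices are functions of a row and a column index; only the entries at positive
  indices are meaningful. The sum in the product runs over the nonzero terms at positive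
  indices, and is the intended one whenever these are finitely many, as is the case for upper
  triangular factors.
\<close>

type_synonym inf_mat = "nat \<Rightarrow> nat \<Rightarrow> nat"

definition mat_one :: inf_mat where
  "mat_one i j = (if i = j then 1 else 0)"

definition mat_mul :: "inf_mat \<Rightarrow> inf_mat \<Rightarrow> inf_mat" where
  "mat_mul A B i j = (\<Sum>k | 1 \<le> k \<and> A i k * B k j \<noteq> 0. A i k * B k j)"

primrec mat_pow :: "inf_mat \<Rightarrow> nat \<Rightarrow> inf_mat" where
  "mat_pow A 0 = mat_one"
| "mat_pow A (Suc m) = mat_mul A (mat_pow A m)"

definition c_mat :: inf_mat where
  "c_mat i j = stirling j i"

definition S_mat :: inf_mat where
  "S_mat i j = Stirling j i"

end

theory Submission
  imports Defs "HOL-Computational_Algebra.Formal_Power_Series"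
begin

text \<open>
  A flat of either arrangement is given by a partition of the coordinates into blocks, where the
  differences \<open>x\<^sub>p - x\<^sub>q\<close> inside a block are fixed integers and different blocks move freely, so
  the dimension is the number of blocks. Which systems of differences occur on a block? The labels of
  the block sit at integer heights, and the pairs whose hyperplane belongs to the arrangement must
  connect the block. Reading the block from bottom to top, this is a condition on consecutive levels
  only. In the Catalan case the levels are arbitrary nonempty sets and consecutive ones are
  \<open>1, \<dots>, m\<close> apart. In the Shi case, order the labels by height and break ties by label; then every
  label forms a level of its own, and there are \<open>m\<close> possible gaps between consecutive labels:
  \<open>0, \<dots>, m - 1\<close> if the label increases and \<open>1, \<dots>, m\<close> if it decreases. Both cases are
  treated at once in the locale \<open>key_arrangement\<close>, where a block is seen as a chain of keys.

  So a block is a chain of levels with \<open>m\<close> choices at each step, and blocks have the exponential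
  generating function \<open>C = T / (1 - m T)\<close> (lemma \<open>card_blocks_on\<close>), where \<open>T = exp x - 1\<close> for Catalan
  and \<open>T = x\<close> for Shi. Flats of dimension \<open>i\<close> correspond to sets of \<open>i\<close> blocks (lemmas
  \<open>flat_is_flat_of\<close>, \<open>flat_of_subset_imp\<close>, \<open>flat_dim_flat_of\<close>), so by the exponential formula their
  generating function is \<open>C^i / i!\<close>.

  On the matrix side, \<open>S\<close> and \<open>c\<close> have the rows \<open>(exp x - 1)^i / i!\<close> and \<open>(- log (1 - x))^i / i!\<close>, and
  the product of matrices of this shape corresponds to substitution of the series (lemma
  \<open>iteration_matrix_mul\<close>). Now \<open>S c\<close> belongs to \<open>exp (- log (1 - x)) - 1 = x / (1 - x)\<close>, whose
  \<open>m\<close>-fold iterate is \<open>x / (1 - m x)\<close>; and \<open>(S c)^m S\<close> arises from this by substituting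
  \<open>exp x - 1\<close>. These are the two series \<open>C\<close>.
\<close>

unbundle fps_syntax

section \<open>Sets of labelled structures\<close>

lemma sum_subsets_by_card:
  fixes h :: "nat \<Rightarrow> 'b::comm_semiring_1"
  assumes "finite A"
  shows "(\<Sum>B\<in>Pow A. h (card B)) = (\<Sum>k=0..card A. of_nat (card A choose k) * h k)"
proof -
  have "(\<Sum>B\<in>Pow A. h (card B)) = (\<Sum>k=0..card A. \<Sum>B\<in>{B \<in> Pow A. card B = k}. h (card B))"
    by (rule sum.group[symmetric]) (use assms in \<open>auto intro: card_mono\<close>)
  also have "\<dots> = (\<Sum>k=0..card A. of_nat (card A choose k) * h k)"
    using n_subsets[OF assms] by (intro sum.cong refl) (simp add: Pow_def)
  finally show ?thesis .
qed

text \<open>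
  The product rule for exponential generating functions: \<open>n! [x^n] F G\<close> counts the ways to split
  an \<open>n\<close>-set in two, with an \<open>F\<close>-structure on one part and a \<open>G\<close>-structure on the other.
\<close>

lemma egf_mult:
  fixes F G :: "real fps"
  assumes "finite A"
  shows "fact (card A) * (F * G) $ card A =
    (\<Sum>B\<in>Pow A. (fact (card B) * F $ card B) * (fact (card (A - B)) * G $ card (A - B)))"
proof -
  let ?n = "card A"
  have "(\<Sum>B\<in>Pow A. (fact (card B) * F $ card B) * (fact (card (A - B)) * G $ card (A - B)))
      = (\<Sum>B\<in>Pow A. (fact (card B) * F $ card B) * (fact (?n - card B) * G $ (?n - card B)))"
    by (intro sum.cong refl) (use assms in \<open>auto simp: card_Diff_subset finite_subset\<close>)
  also have "\<dots> = (\<Sum>k=0..?n. real (?n choose k) * ((fact k * F $ k) * (fact (?n - k) * G $ (?n - k))))"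
    by (rule sum_subsets_by_card[OF assms])
  also have "\<dots> = (\<Sum>k=0..?n. fact ?n * (F $ k * G $ (?n - k)))"
    by (intro sum.cong refl) (simp add: binomial_fact field_simps)
  finally show ?thesis by (simp add: fps_mult_nth sum_distrib_left)
qed

text \<open>
  The labelled structures of a species are the elements of \<open>S\<close>, and \<open>supp\<close> gives the label set of
  each of them.
\<close>

definition assemblies :: "('s \<Rightarrow> 'a set) \<Rightarrow> 's set \<Rightarrow> 'a set \<Rightarrow> nat \<Rightarrow> 's set set" where
  "assemblies supp S A i =
     {P. P \<subseteq> S \<and> finite P \<and> card P = i \<and> disjoint_family_on supp P \<and> \<Union>(supp ` P) = A}"

lemma assemblies_Suc_insert:
  assumes P: "P \<in> assemblies supp S (A - supp s) i" and s: "s \<in> S" "supp s \<subseteq> A" "supp s \<noteq> {}"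
  shows "s \<notin> P" "insert s P \<in> assemblies supp S A (Suc i)"
proof -
  show "s \<notin> P" using P s by (auto simp: assemblies_def disjoint_family_on_def)
  thus "insert s P \<in> assemblies supp S A (Suc i)"
    using P s by (auto simp: assemblies_def disjoint_family_on_def)
qed

lemma assemblies_Suc_remove:
  assumes P: "P \<in> assemblies supp S A (Suc i)" and s: "s \<in> P"
  shows "P - {s} \<in> assemblies supp S (A - supp s) i" "s \<in> S" "supp s \<subseteq> A"
  using assms by (auto simp: assemblies_def disjoint_family_on_def)

text \<open>
  The exponential formula. An assembly of \<open>i + 1\<close> structures with one of them marked is the same as
  the marked structure \<open>s\<close> together with an assembly of \<open>i\<close> structures on the labels that
  \<open>s\<close> leaves free. Hence \<open>i + 1\<close> times the generating function of these assemblies is \<open>C\<close> times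
  that of assemblies of \<open>i\<close> structures, which leads to \<open>C^i / i!\<close>.
\<close>

lemma exponential_formula:
  fixes C :: "real fps" and supp :: "'s \<Rightarrow> 'a set"
  assumes A: "finite A"
    and ne: "\<And>s. s \<in> S \<Longrightarrow> supp s \<noteq> {}"
    and fin: "\<And>B. B \<subseteq> A \<Longrightarrow> finite {s \<in> S. supp s = B}"
    and card: "\<And>B. B \<subseteq> A \<Longrightarrow> real (card {s \<in> S. supp s = B}) = fact (card B) * C $ card B"
  shows "real (card (assemblies supp S A i)) = fact (card A) / fact i * (C ^ i) $ card A"
proof -
  have finite_assemblies: "finite (assemblies supp S A' j)" if "A' \<subseteq> A" for A' j
  proof (rule finite_subset)
    show "assemblies supp S A' j \<subseteq> Pow (\<Union>B\<in>Pow A. {s \<in> S. supp s = B})"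
      using that unfolding assemblies_def by blast
    show "finite (Pow (\<Union>B\<in>Pow A. {s \<in> S. supp s = B}))"
      using A fin by auto
  qed
  have "real (card (assemblies supp S A' i)) = fact (card A') / fact i * (C ^ i) $ card A'"
    if "A' \<subseteq> A" for A'
    using that
  proof (induction i arbitrary: A')
    case 0
    have "finite A'" using 0 A finite_subset by blast
    moreover have "assemblies supp S A' 0 = (if A' = {} then {{}} else {})"
      by (auto simp: assemblies_def disjoint_family_on_def)
    ultimately show ?case by (simp add: card_eq_0_iff)
  next
    case (Suc i A')
    have A': "finite A'" using Suc.prems A finite_subset by blast
    let ?marked = "SIGMA P:assemblies supp S A' (Suc i). P"
    let ?split = "SIGMA B:Pow A'. {s \<in> S. supp s = B} \<times> assemblies supp S (A' - B) i"
    have "bij_betw (\<lambda>(P, s). (supp s, s, P - {s})) ?marked ?split"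
    proof (rule bij_betw_byWitness[where f' = "\<lambda>(B, s, P). (insert s P, s)"])
      show "\<forall>x\<in>?marked. (\<lambda>(B, s, P). (insert s P, s)) ((\<lambda>(P, s). (supp s, s, P - {s})) x) = x"
        by auto
      show "\<forall>y\<in>?split. (\<lambda>(P, s). (supp s, s, P - {s})) ((\<lambda>(B, s, P). (insert s P, s)) y) = y"
        using assemblies_Suc_insert(1)[of _ supp S] ne by fastforce
      show "(\<lambda>(P, s). (supp s, s, P - {s})) ` ?marked \<subseteq> ?split"
        using assemblies_Suc_remove[of _ supp S A' i] by fastforce
      show "(\<lambda>(B, s, P). (insert s P, s)) ` ?split \<subseteq> ?marked"
        using assemblies_Suc_insert(2)[of _ supp S A'] ne by fastforce
    qed
    hence "card ?marked = card ?split" by (rule bij_betw_same_card)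
    moreover have "card ?marked = Suc i * card (assemblies supp S A' (Suc i))"
      using finite_assemblies[OF Suc.prems, of "Suc i"] by (simp add: assemblies_def)
    moreover have fin': "finite (assemblies supp S (A' - B) i)" for B
      using Suc.prems by (intro finite_assemblies) blast
    have "card ?split = (\<Sum>B\<in>Pow A'. card {s \<in> S. supp s = B} * card (assemblies supp S (A' - B) i))"
      using A' fin fin' Suc.prems
      by (subst card_SigmaI) (auto simp: card_cartesian_product intro!: finite_cartesian_product)
    ultimately have "real (Suc i) * real (card (assemblies supp S A' (Suc i)))
        = (\<Sum>B\<in>Pow A'. real (card {s \<in> S. supp s = B}) * real (card (assemblies supp S (A' - B) i)))"
      by (simp flip: of_nat_mult of_nat_sum del: of_nat_Suc mult_Suc)
    also have "\<dots> = (\<Sum>B\<in>Pow A'. (fact (card B) * C $ card B) *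
                       (fact (card (A' - B)) * (fps_const (1 / fact i) * C ^ i) $ card (A' - B)))"
    proof (intro sum.cong refl arg_cong2[where f = "(*)"])
      fix B assume "B \<in> Pow A'"
      hence "B \<subseteq> A" "A' - B \<subseteq> A" using Suc.prems by auto
      thus "real (card {s \<in> S. supp s = B}) = fact (card B) * C $ card B"
        "real (card (assemblies supp S (A' - B) i)) =
           fact (card (A' - B)) * (fps_const (1 / fact i) * C ^ i) $ card (A' - B)"
        using card Suc.IH by simp_all
    qed
    also have "\<dots> = fact (card A') * (C * (fps_const (1 / fact i) * C ^ i)) $ card A'"
      by (rule egf_mult[OF A', symmetric])
    also have "C * (fps_const (1 / fact i) * C ^ i) = fps_const (1 / fact i) * C ^ Suc i"
      by (simp add: mult_ac)
    also have "fact (card A') * (fps_const (1 / fact i) * C ^ Suc i) $ card A'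
        = real (Suc i) * (fact (card A') / fact (Suc i) * (C ^ Suc i) $ card A')"
      by (simp add: field_simps del: of_nat_Suc power_Suc)
    finally show ?case by (subst (asm) mult_left_cancel) simp_all
  qed
  thus ?thesis by simp
qed

section \<open>Stirling matrices as substitution of power series\<close>

text \<open>
  The matrix \<open>A\<close> is the iteration matrix of \<open>f\<close>: its \<open>i\<close>-th row has the exponential generating
  function \<open>f^i / i!\<close>. Row \<open>0\<close> is left out because only entries at positive indices have a
  meaning.
\<close>

definition iteration_matrix :: "real fps \<Rightarrow> inf_mat \<Rightarrow> bool" where
  "iteration_matrix f A \<longleftrightarrow>
     f $ 0 = 0 \<and> (\<forall>i\<ge>1. \<forall>j. real (A i j) = fact j / fact i * (f ^ i) $ j)"

lemma iteration_matrix_one: "iteration_matrix fps_X mat_one"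
  by (auto simp: iteration_matrix_def mat_one_def fps_X_power_nth)

text \<open>
  Multiplying by \<open>B\<close> substitutes \<open>g\<close>: row \<open>i\<close> of the product has the generating function
  \<open>\<Sum>\<^sub>k (k! [y^k] f^i / i!) \<cdot> g^k / k!\<close>, which is \<open>f^i / i!\<close> evaluated at \<open>g\<close>.
\<close>

lemma iteration_matrix_mul:
  assumes A: "iteration_matrix f A" and B: "iteration_matrix g B"
  shows "iteration_matrix (f oo g) (mat_mul A B)"
  unfolding iteration_matrix_def
proof (intro conjI allI impI)
  have f0: "f $ 0 = 0" and g0: "g $ 0 = 0" using A B by (auto simp: iteration_matrix_def)
  show "(f oo g) $ 0 = 0" by (simp add: f0)
  fix i j :: nat assume i: "i \<ge> 1"
  have Ai: "real (A i k) = fact k / fact i * (f ^ i) $ k" for k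
    using A i by (simp add: iteration_matrix_def)
  have Bk: "real (B k j) = fact j / fact k * (g ^ k) $ j" if "k \<ge> 1" for k
    using B that by (simp add: iteration_matrix_def)
  have upper: "B k j = 0" if "k > j" for k
    using Bk[of k] startsby_zero_power_prefix[OF g0, of k] that by auto
  have "{k. 1 \<le> k \<and> A i k * B k j \<noteq> 0} \<subseteq> {1..j}"
  proof
    fix k assume "k \<in> {k. 1 \<le> k \<and> A i k * B k j \<noteq> 0}"
    thus "k \<in> {1..j}" using upper[of k] by (cases "k > j") auto
  qed
  hence "mat_mul A B i j = (\<Sum>k=1..j. A i k * B k j)"
    unfolding mat_mul_def by (intro sum.mono_neutral_left) auto
  hence "real (mat_mul A B i j) = (\<Sum>k=1..j. real (A i k) * real (B k j))" by simp
  also have "\<dots> = (\<Sum>k=1..j. fact j / fact i * ((f ^ i) $ k * (g ^ k) $ j))"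
    by (intro sum.cong refl) (simp add: Ai Bk)
  also have "\<dots> = (\<Sum>k=0..j. fact j / fact i * ((f ^ i) $ k * (g ^ k) $ j))"
    using f0 i by (intro sum.mono_neutral_left) (auto simp: not_le fps_nth_power_0)
  also have "\<dots> = fact j / fact i * ((f ^ i) oo g) $ j"
    by (simp add: fps_compose_nth sum_distrib_left)
  also have "(f ^ i) oo g = (f oo g) ^ i"
    by (simp add: fps_compose_power[OF g0])
  finally show "real (mat_mul A B i j) = fact j / fact i * ((f oo g) ^ i) $ j" .
qed

lemma fps_nth_deriv_power_Suc:
  "(fps_deriv f * f ^ i) $ j = of_nat (Suc j) / of_nat (Suc i) * (f ^ Suc i) $ Suc j"
  for f :: "real fps"
proof -
  have "fps_deriv (f ^ Suc i) $ j = of_nat (Suc i) * (fps_deriv f * f ^ i) $ j"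
    by (simp only: fps_deriv_power mult.assoc fps_mult_left_const_nth) (simp add: mult.assoc)
  thus ?thesis by (simp add: field_simps del: power_Suc)
qed

text \<open>
  With \<open>E = exp x - 1\<close> one has \<open>(E^(k+1) / (k+1)!)' = (k+1) E^(k+1) / (k+1)! + E^k / k!\<close>, which on
  coefficients is the recurrence of the Stirling numbers of the second kind.
\<close>

lemma iteration_matrix_S: "iteration_matrix (fps_exp 1 - 1) S_mat"
proof -
  let ?E = "fps_exp 1 - 1 :: real fps"
  have "real (Stirling j i) = fact j / fact i * (?E ^ i) $ j" for i j
  proof (induction j arbitrary: i)
    case 0 show ?case by (cases i) (auto simp: fps_nth_power_0)
  next
    case (Suc j)
    show ?case
    proof (cases i)
      case 0 thus ?thesis by simp
    next
      case (Suc k)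
      have "fps_deriv ?E * ?E ^ k = ?E ^ k + ?E ^ Suc k" by (simp add: algebra_simps)
      hence "(?E ^ k) $ j + (?E ^ Suc k) $ j = real (Suc j) / real (Suc k) * (?E ^ Suc k) $ Suc j"
        using fps_nth_deriv_power_Suc[of ?E k j] by (simp del: power_Suc)
      note eq = this
      have "real (Stirling (Suc j) i) = real (Suc k) * real (Stirling j (Suc k)) + real (Stirling j k)"
        by (simp add: Suc algebra_simps)
      also have "\<dots> = fact j / fact k * ((?E ^ k) $ j + (?E ^ Suc k) $ j)"
        unfolding Suc.IH by (simp add: field_simps del: power_Suc of_nat_Suc)
      also have "\<dots> = fact (Suc j) / fact i * (?E ^ i) $ Suc j"
        unfolding eq Suc by (simp add: field_simps del: power_Suc of_nat_Suc)
      finally show ?thesis .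
    qed
  qed
  thus ?thesis by (simp add: iteration_matrix_def S_mat_def)
qed

text \<open>
  The power series of \<open>- log (1 - x)\<close>.
\<close>

definition neg_log :: "real fps" where
  "neg_log = Abs_fps (\<lambda>n. if n = 0 then 0 else 1 / of_nat n)"

lemma fps_deriv_neg_log: "fps_deriv neg_log * (1 - fps_X) = 1"
proof -
  have "fps_deriv neg_log = Abs_fps (\<lambda>_. 1)"
    by (rule fps_ext) (simp add: neg_log_def del: of_nat_Suc)
  thus ?thesis by (intro fps_ext) (simp add: right_diff_distrib fps_X_mult_right_nth)
qed

text \<open>
  Here the differential equation is \<open>(1 - x) (L^(k+1) / (k+1)!)' = L^k / k!\<close>; on coefficients it is
  the recurrence of the Stirling numbers of the first kind.
\<close>

lemma iteration_matrix_c: "iteration_matrix neg_log c_mat"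
proof -
  have "real (stirling j i) = fact j / fact i * (neg_log ^ i) $ j" for i j
  proof (induction j arbitrary: i)
    case 0 show ?case by (cases i) (auto simp: fps_nth_power_0 neg_log_def)
  next
    case (Suc j)
    show ?case
    proof (cases i)
      case 0 thus ?thesis by simp
    next
      case (Suc k)
      have "(fps_deriv neg_log * neg_log ^ k) * (1 - fps_X) = neg_log ^ k"
        using fps_deriv_neg_log by (simp add: mult_ac)
      note prod = this
      have "(neg_log ^ k) $ j = (fps_deriv neg_log * neg_log ^ k) $ j
          - (if j = 0 then 0 else (fps_deriv neg_log * neg_log ^ k) $ (j - 1))"
        using arg_cong[of _ _ "\<lambda>F. F $ j", OF prod] by (simp add: right_diff_distrib fps_X_mult_right_nth)
      also have "\<dots> = (real (Suc j) * (neg_log ^ Suc k) $ Suc j - real j * (neg_log ^ Suc k) $ j) / real (Suc k)"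
        unfolding fps_nth_deriv_power_Suc
        by (cases j) (simp_all add: field_simps del: power_Suc of_nat_Suc)
      finally have eq: "real (Suc k) * (neg_log ^ k) $ j + real j * (neg_log ^ Suc k) $ j
          = real (Suc j) * (neg_log ^ Suc k) $ Suc j"
        by (simp add: field_simps del: power_Suc of_nat_Suc)
      have "real (stirling (Suc j) i) = real j * real (stirling j (Suc k)) + real (stirling j k)"
        by (simp add: Suc algebra_simps)
      also have "\<dots> = fact j / fact (Suc k) *
          (real (Suc k) * (neg_log ^ k) $ j + real j * (neg_log ^ Suc k) $ j)"
        unfolding Suc.IH by (simp add: field_simps del: power_Suc of_nat_Suc)
      also have "\<dots> = fact (Suc j) / fact i * (neg_log ^ i) $ Suc j"
        unfolding eq Suc by (simp add: field_simps del: power_Suc of_nat_Suc)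
      finally show ?thesis .
    qed
  qed
  thus ?thesis by (simp add: iteration_matrix_def c_mat_def neg_log_def)
qed

text \<open>
  If \<open>T\<close> counts the possible levels, then \<open>T / (1 - m T) = T + m T^2 + m^2 T^3 + \<dots>\<close> counts
  sequences of levels in which each step between neighbouring levels is made in one of \<open>m\<close> ways.
\<close>

definition chain_egf :: "nat \<Rightarrow> real fps \<Rightarrow> real fps" where
  "chain_egf m T = T * inverse (1 - of_nat m * T)"

text \<open>
  The fixed point equation (a chain is one level, or a top level, a step, and a shorter chain)
  determines the series. It is easier to work with than the quotient.
\<close>

lemma chain_egf_iff:
  assumes "T $ 0 = 0"
  shows "C = chain_egf m T \<longleftrightarrow> C = T + of_nat m * (T * C)"
proof -
  let ?U = "1 - of_nat m * T"
  have U0: "?U $ 0 = 1" using assms by (simp add: fps_mult_nth)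
  hence "?U \<noteq> 0" by (metis fps_zero_nth zero_neq_one)
  hence "C = chain_egf m T \<longleftrightarrow> C * ?U = chain_egf m T * ?U" by simp
  also have "chain_egf m T * ?U = T"
  proof -
    have "inverse ?U * ?U = 1" by (rule inverse_mult_eq_1) (simp only: U0 one_neq_zero not_False_eq_True)
    thus ?thesis unfolding chain_egf_def mult.assoc by simp
  qed
  also have "C * ?U = T \<longleftrightarrow> C = T + of_nat m * (T * C)" by (simp add: algebra_simps)
  finally show ?thesis .
qed

lemma chain_egf_0: "T $ 0 = 0 \<Longrightarrow> chain_egf m T $ 0 = 0"
  by (simp add: chain_egf_def)

lemma chain_egf_compose:
  assumes T: "T $ 0 = 0" and G: "G $ 0 = 0"
  shows "chain_egf m T oo G = chain_egf m (T oo G)"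
proof -
  have "chain_egf m T = T + of_nat m * (T * chain_egf m T)"
    using chain_egf_iff[OF T] by blast
  hence "chain_egf m T oo G = (T + of_nat m * (T * chain_egf m T)) oo G" by simp
  also have "\<dots> = (T oo G) + of_nat m * ((T oo G) * (chain_egf m T oo G))"
    by (simp add: fps_compose_add_distrib fps_compose_mult_distrib[OF G] flip: fps_of_nat)
  finally show ?thesis using chain_egf_iff[of "T oo G"] T by simp
qed

text \<open>
  Chains of chains: if the steps inside the chains have \<open>m\<close> types and those between them have
  \<open>k\<close> other types, the outcome is a chain with \<open>k + m\<close> types of steps. In terms of substitution,
  \<open>x / (1 - m x)\<close> is the \<open>m\<close>-fold iterate of \<open>x / (1 - x)\<close>.
\<close>

lemma chain_egf_chain_egf:
  assumes T: "T $ 0 = 0"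
  shows "chain_egf k (chain_egf m T) = chain_egf (k + m) T"
proof -
  let ?C = "chain_egf m T" and ?D = "chain_egf k (chain_egf m T)"
  have C: "?C = T + of_nat m * (T * ?C)" using chain_egf_iff[OF T] by blast
  have D: "?D = ?C + of_nat k * (?C * ?D)" using chain_egf_iff[OF chain_egf_0[OF T]] by blast
  let ?U = "1 - of_nat m * T"
  have CU: "?C * ?U = T" using C by (simp add: algebra_simps)
  have "?D * ?U = T + of_nat k * (T * ?D)"
  proof -
    have "?D * ?U = (?C + of_nat k * (?C * ?D)) * ?U" using D by simp
    also have "\<dots> = ?C * ?U + of_nat k * (?C * ?U * ?D)" by (simp add: algebra_simps)
    finally show ?thesis by (simp only: CU)
  qed
  hence "?D = T + of_nat (k + m) * (T * ?D)" by (simp add: algebra_simps)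
  thus ?thesis using chain_egf_iff[OF T] by blast
qed

text \<open>
  This is \<open>exp (- log (1 - x)) - 1 = x / (1 - x)\<close>. The exponential \<open>G\<close> satisfies
  \<open>G' (1 - x) = G\<close>, so \<open>G (1 - x)\<close> has derivative \<open>0\<close> and is the constant \<open>1\<close>.
\<close>

lemma exp_minus_one_compose_neg_log: "(fps_exp 1 - 1) oo neg_log = chain_egf 1 fps_X"
proof -
  have n0: "neg_log $ 0 = 0" by (simp add: neg_log_def)
  define G :: "real fps" where "G = fps_exp 1 oo neg_log"
  have "fps_deriv G = G * fps_deriv neg_log"
    by (simp add: G_def fps_compose_deriv[OF n0])
  hence "fps_deriv (G * (1 - fps_X)) = G * (fps_deriv neg_log * (1 - fps_X)) - G"
    by (simp add: algebra_simps)
  also have "\<dots> = 0" by (simp add: fps_deriv_neg_log)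
  finally have "G * (1 - fps_X) = fps_const ((G * (1 - fps_X)) $ 0)"
    by (simp only: fps_deriv_eq_0_iff)
  hence "G * (1 - fps_X) = 1" by (simp add: G_def)
  hence "G - 1 = fps_X + of_nat 1 * (fps_X * (G - 1))" by (simp add: algebra_simps)
  hence "G - 1 = chain_egf 1 fps_X" using chain_egf_iff[of fps_X] by simp
  thus ?thesis by (simp add: G_def fps_compose_sub_distrib)
qed

lemma iteration_matrix_Sc_power:
  "iteration_matrix (chain_egf m fps_X) (mat_pow (mat_mul S_mat c_mat) m)"
proof (induction m)
  case 0 thus ?case by (simp add: chain_egf_def iteration_matrix_one)
next
  case (Suc m)
  have "iteration_matrix (chain_egf 1 fps_X) (mat_mul S_mat c_mat)"
    using iteration_matrix_mul[OF iteration_matrix_S iteration_matrix_c]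
    by (simp only: exp_minus_one_compose_neg_log)
  from iteration_matrix_mul[OF this Suc] show ?case
    by (simp add: chain_egf_compose chain_egf_0 chain_egf_chain_egf)
qed

lemma iteration_matrix_Sc_power_S:
  "iteration_matrix (chain_egf m (fps_exp 1 - 1)) (mat_mul (mat_pow (mat_mul S_mat c_mat) m) S_mat)"
  using iteration_matrix_mul[OF iteration_matrix_Sc_power iteration_matrix_S]
  by (simp add: chain_egf_compose)

section \<open>Counting blocks\<close>

text \<open>
  Both families are instances of one arrangement on the coordinates \<open>1, \<dots>, n\<close>. A label \<open>p\<close> at
  height \<open>h\<close> gets the key \<open>D h + r p\<close>, and the hyperplane \<open>x\<^sub>p - x\<^sub>q = a\<close> belongs to the
  arrangement if it puts \<open>p\<close> and \<open>q\<close> at keys that differ by less than \<open>W\<close>. For the extended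
  Catalan arrangement keys are heights (\<open>D = 1\<close>, \<open>r = 0\<close>, \<open>W = m + 1\<close>). For the extended Shi
  arrangement the height is refined by the label (\<open>D = n + 1\<close>, \<open>r p = p\<close>, \<open>W = D m\<close>), which turns
  the asymmetric range \<open>1 - m \<le> a \<le> m\<close> into a symmetric condition on keys and makes all keys
  distinct.

  Two features matter for the count. The first is the number \<open>m\<close> of heights that place a label
  strictly above, but less than \<open>W\<close> above, a given key of another label. The second is which sets of labels can share a
  key; this depends on the size alone, and \<open>tie_sizes\<close> holds the possible sizes.
\<close>

locale key_arrangement =
  fixes n D W m :: nat and r :: "nat \<Rightarrow> nat" and tie_sizes :: "nat set"
  assumes r_less: "p \<in> {1..n} \<Longrightarrow> r p < D"
    and W_pos: "0 < W"
    and gap_count: "\<lbrakk>p \<in> {1..n}; q \<in> {1..n}; p \<noteq> q\<rbrakk> \<Longrightarrow>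
          card {v. D * u + r q < D * v + r p \<and> D * v + r p < D * u + r q + W} = m"
    and tie: "\<lbrakk>P \<subseteq> {1..n}; P \<noteq> {}\<rbrakk> \<Longrightarrow>
          (\<forall>p\<in>P. \<forall>q\<in>P. r p = r q) \<longleftrightarrow> card P \<in> tie_sizes"
    and tie_sizes_pos: "0 \<notin> tie_sizes"
begin

definition key :: "(nat \<rightharpoonup> nat) \<Rightarrow> nat \<Rightarrow> nat" where
  "key b p = D * the (b p) + r p"

text \<open>
  A block assigns heights to some labels. It is linked if, in order of increasing keys, every step to
  the next key is shorter than \<open>W\<close>.
\<close>

definition linked :: "(nat \<rightharpoonup> nat) \<Rightarrow> bool" where
  "linked b \<longleftrightarrow> (\<forall>p\<in>dom b. (\<exists>q\<in>dom b. key b p < key b q) \<longrightarrow>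
      (\<exists>q\<in>dom b. key b p < key b q \<and> key b q < key b p + W))"

text \<open>
  Heights matter only up to a common translation, so the lowest height is taken to be \<open>0\<close>.
\<close>

definition blocks :: "(nat \<rightharpoonup> nat) set" where
  "blocks = {b. dom b \<subseteq> {1..n} \<and> 0 \<in> ran b \<and> linked b}"

definition top_key :: "(nat \<rightharpoonup> nat) \<Rightarrow> nat" where
  "top_key b = Max (key b ` dom b)"

definition top_level :: "(nat \<rightharpoonup> nat) \<Rightarrow> nat set" where
  "top_level b = {p \<in> dom b. key b p = top_key b}"

text \<open>
  Equal keys force equal heights because \<open>0 \<le> r p < D\<close> makes \<open>r p\<close> the remainder of the key.
\<close>

lemma key_eqD:
  assumes "p \<in> {1..n}" "q \<in> {1..n}" "D * u + r p = D * v + r q"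
  shows "u = v" "r p = r q"
proof -
  have "(D * u + r p) div D = u" "(D * v + r q) div D = v"
    using r_less[OF assms(1)] r_less[OF assms(2)] by simp_all
  thus "u = v" using assms(3) by metis
  thus "r p = r q" using assms(3) by simp
qed

lemma blocksD:
  assumes "b \<in> blocks"
  shows "dom b \<subseteq> {1..n}" "finite (dom b)" "dom b \<noteq> {}" "0 \<in> ran b" "linked b"
  using assms finite_subset[of "dom b" "{1..n}"] by (auto simp: blocks_def ran_def)

lemma key_le_top_key: "finite (dom b) \<Longrightarrow> p \<in> dom b \<Longrightarrow> key b p \<le> top_key b"
  unfolding top_key_def by (rule Max_ge) auto

lemma top_key_attained:
  assumes "finite (dom b)" "dom b \<noteq> {}"
  obtains p where "p \<in> dom b" "key b p = top_key b"
proof -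
  have "top_key b \<in> key b ` dom b"
    unfolding top_key_def using assms by (intro Max_in) auto
  thus ?thesis using that by (metis imageE)
qed

text \<open>
  The heights at which the labels of \<open>P\<close> can be placed above \<open>b\<close> as a new top level so that the
  result is again linked.
\<close>

definition gaps :: "(nat \<rightharpoonup> nat) \<Rightarrow> nat set \<Rightarrow> nat set" where
  "gaps b P = {v. \<forall>p\<in>P. top_key b < D * v + r p \<and> D * v + r p < top_key b + W}"

lemma card_gaps:
  assumes b: "b \<in> blocks" and P: "P \<subseteq> {1..n}" "P \<inter> dom b = {}" "card P \<in> tie_sizes"
  shows "card (gaps b P) = m"
proof -
  have "P \<noteq> {}" using P(3) tie_sizes_pos by auto
  then obtain p where p: "p \<in> P" by blast
  have same: "\<forall>q\<in>P. r q = r p" using tie[OF P(1) \<open>P \<noteq> {}\<close>] P(3) p by blast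
  obtain q where q: "q \<in> dom b" "key b q = top_key b"
    by (rule top_key_attained[OF blocksD(2,3)[OF b]])
  have "gaps b P = {v. top_key b < D * v + r p \<and> D * v + r p < top_key b + W}"
    unfolding gaps_def using p by (intro Collect_cong) (metis same)
  also have "\<dots> = {v. D * the (b q) + r q < D * v + r p \<and> D * v + r p < D * the (b q) + r q + W}"
    by (simp add: q(2)[symmetric] key_def)
  finally have "gaps b P = \<dots>" .
  moreover have "p \<in> {1..n}" "q \<in> {1..n}" "p \<noteq> q" using p q(1) P(1,2) blocksD(1)[OF b] by blast+
  ultimately show ?thesis using gap_count[of p q "the (b q)"] by metis
qed

lemma finite_gaps:
  assumes "P \<subseteq> {1..n}" "P \<noteq> {}"
  shows "finite (gaps b P)"
proof -
  obtain p where p: "p \<in> P" using assms by blast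
  hence "0 < D" using r_less[of p] assms by auto
  have "gaps b P \<subseteq> {..top_key b + W}"
  proof
    fix v assume "v \<in> gaps b P"
    hence "D * v + r p < top_key b + W" using p by (auto simp: gaps_def)
    moreover have "v \<le> D * v" using \<open>0 < D\<close> by (cases D) auto
    ultimately have "v \<le> top_key b + W" by linarith
    thus "v \<in> {..top_key b + W}" by simp
  qed
  thus ?thesis using finite_subset by blast
qed

definition put_on_top :: "(nat \<rightharpoonup> nat) \<Rightarrow> nat set \<Rightarrow> nat \<Rightarrow> (nat \<rightharpoonup> nat)" where
  "put_on_top b P v = (\<lambda>p. if p \<in> P then Some v else b p)"

text \<open>
  Together with the inverse operation below, this reduces counting blocks to counting blocks on fewer
  labels. The only new step between neighbouring keys is the one from the old top to the new one, and
  it is shorter than \<open>W\<close> by the choice of \<open>v\<close>.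
\<close>

lemma put_on_top_in_blocks:
  assumes b: "b \<in> blocks" and P: "P \<subseteq> {1..n}" "P \<inter> dom b = {}" "card P \<in> tie_sizes"
    and v: "v \<in> gaps b P"
  shows "put_on_top b P v \<in> blocks" "dom (put_on_top b P v) = dom b \<union> P"
    "top_level (put_on_top b P v) = P"
proof -
  let ?b = "put_on_top b P v"
  show dom: "dom ?b = dom b \<union> P" by (auto simp: put_on_top_def split: if_splits)
  have "P \<noteq> {}" using P(3) tie_sizes_pos by auto
  then obtain p0 where p0: "p0 \<in> P" by blast
  have same: "r p = r p0" if "p \<in> P" for p using tie[OF P(1) \<open>P \<noteq> {}\<close>] P(3) p0 that by blast
  have keyP: "key ?b p = D * v + r p0" if "p \<in> P" for p
    using same[OF that] that by (simp add: key_def put_on_top_def)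
  have keyb: "key ?b p = key b p" if "p \<in> dom b" for p
    using P(2) that by (auto simp: key_def put_on_top_def)
  have v': "top_key b < D * v + r p0" "D * v + r p0 < top_key b + W"
    using v p0 by (auto simp: gaps_def)
  have le: "key ?b p < D * v + r p0" if "p \<in> dom b" for p
    using key_le_top_key[of b p] blocksD(2)[OF b] that keyb v' by fastforce
  have fin: "finite (dom ?b)"
    using dom blocksD(2)[OF b] finite_subset[OF P(1)] by simp
  have leq: "key ?b p \<le> D * v + r p0" if "p \<in> dom ?b" for p
  proof (cases "p \<in> P")
    case True thus ?thesis using keyP by simp
  next
    case False thus ?thesis using that dom le[of p] by simp
  qed
  have top: "top_key ?b = D * v + r p0"
    unfolding top_key_def
  proof (rule Max_eqI)
    show "finite (key ?b ` dom ?b)" using fin by simp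
    show "y \<le> D * v + r p0" if "y \<in> key ?b ` dom ?b" for y
      using that leq by auto
    show "D * v + r p0 \<in> key ?b ` dom ?b" using keyP[OF p0] dom p0 by force
  qed
  show "top_level ?b = P"
  proof (intro set_eqI iffI)
    fix p assume "p \<in> top_level ?b"
    hence "p \<in> dom b \<union> P" "key ?b p = D * v + r p0" using dom top by (simp_all add: top_level_def)
    thus "p \<in> P" using le[of p] by auto
  next
    fix p assume "p \<in> P"
    thus "p \<in> top_level ?b" using dom top keyP[of p] by (simp add: top_level_def)
  qed
  have "linked ?b" unfolding linked_def
  proof (intro ballI impI)
    fix p assume p: "p \<in> dom ?b" "\<exists>q\<in>dom ?b. key ?b p < key ?b q"
    have "p \<notin> P" using p(2) keyP[of p] leq by (metis not_le)
    hence pb: "p \<in> dom b" using p(1) dom by simp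
    show "\<exists>q\<in>dom ?b. key ?b p < key ?b q \<and> key ?b q < key ?b p + W"
    proof (cases "\<exists>q\<in>dom b. key b p < key b q")
      case True
      then obtain q where "q \<in> dom b" "key b p < key b q" "key b q < key b p + W"
        using blocksD(5)[OF b] pb unfolding linked_def by blast
      thus ?thesis using keyb[of p] keyb[of q] pb dom by (intro bexI[of _ q]) simp_all
    next
      case False
      obtain q where "q \<in> dom b" "key b q = top_key b"
        by (rule top_key_attained[OF blocksD(2,3)[OF b]])
      hence "top_key b \<le> key b p" using False by (metis not_le)
      thus ?thesis using v' keyP[OF p0] le[OF pb] keyb[OF pb] dom p0
        by (intro bexI[of _ p0]) auto
    qed
  qed
  moreover have "0 \<in> ran ?b"
  proof -
    obtain p where "b p = Some 0" using blocksD(4)[OF b] by (auto simp: ran_def)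
    moreover from this have "p \<notin> P" using P(2) by auto
    ultimately show ?thesis by (auto simp: put_on_top_def ran_def)
  qed
  ultimately show "?b \<in> blocks" using dom blocksD(1)[OF b] P(1) by (simp add: blocks_def)
qed

lemma top_level_nonempty: "b \<in> blocks \<Longrightarrow> top_level b \<noteq> {}"
  by (metis (mono_tags, lifting) blocksD(2,3) empty_Collect_eq top_key_attained top_level_def)

lemma top_level_props:
  assumes b: "b \<in> blocks"
  shows "card (top_level b) \<in> tie_sizes"
    and "p \<in> top_level b \<Longrightarrow> q \<in> top_level b \<Longrightarrow> b p = b q"
proof -
  let ?P = "top_level b"
  have sub: "?P \<subseteq> {1..n}" using blocksD(1)[OF b] by (auto simp: top_level_def)
  have ne: "?P \<noteq> {}" by (rule top_level_nonempty[OF b])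
  have eq: "the (b p) = the (b q)" "r p = r q" if "p \<in> ?P" "q \<in> ?P" for p q
  proof -
    have "key b p = key b q" using that by (simp add: top_level_def)
    thus "the (b p) = the (b q)" "r p = r q"
      using key_eqD[of p q "the (b p)" "the (b q)"] that sub unfolding key_def by blast+
  qed
  show "card ?P \<in> tie_sizes" using tie[OF sub ne] eq by blast
  show "b p = b q" if "p \<in> ?P" "q \<in> ?P" for p q
    using eq(1)[OF that] that by (auto simp: top_level_def)
qed

text \<open>
  Removing the top level keeps a block linked, since it only deletes the largest key. The lowest
  height stays \<open>0\<close>: if a label of the top level has height \<open>0\<close>, then its key is less than \<open>D\<close>,
  so every label has a key less than \<open>D\<close> and therefore height \<open>0\<close>.
\<close>

lemma remove_top_level:
  assumes b: "b \<in> blocks" and proper: "top_level b \<noteq> dom b" and p0: "p0 \<in> top_level b"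
  defines "b' \<equiv> b |` (- top_level b)"
  shows "b' \<in> blocks" "dom b' = dom b - top_level b" "the (b p0) \<in> gaps b' (top_level b)"
    "put_on_top b' (top_level b) (the (b p0)) = b"
proof -
  let ?P = "top_level b"
  have Psub: "?P \<subseteq> dom b" by (auto simp: top_level_def)
  show dom: "dom b' = dom b - ?P" by (auto simp: b'_def)
  have key: "key b' p = key b p" if "p \<in> dom b'" for p
    using that dom by (simp add: key_def b'_def)
  have fin: "finite (dom b')" using dom blocksD(2)[OF b] by simp
  have below: "key b' p < top_key b" if "p \<in> dom b'" for p
    using key_le_top_key[OF blocksD(2)[OF b], of p] that key[OF that] dom by (auto simp: top_level_def)
  have ne: "dom b' \<noteq> {}" using proper Psub dom by blast
  obtain t where t: "t \<in> dom b'" "key b' t = top_key b'"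
    by (rule top_key_attained[OF fin ne])
  have keyP: "D * the (b p0) + r p = top_key b" if "p \<in> ?P" for p
    using top_level_props(2)[OF b p0 that] that by (simp add: top_level_def key_def)
  have keyP': "key b p = top_key b" if "p \<in> ?P" for p
    using that by (simp add: top_level_def)
  have "\<exists>q\<in>dom b. key b t < key b q"
    using p0 keyP'[OF p0] below[OF t(1)] key[OF t(1)] Psub
    by (intro bexI[of _ p0]) auto
  then obtain q where q: "q \<in> dom b" "key b t < key b q" "key b q < key b t + W"
    using blocksD(5)[OF b] t(1) dom unfolding linked_def by blast
  have "q \<in> ?P"
    using q key_le_top_key[OF fin, of q] t key dom by (cases "q \<in> ?P") auto
  hence step: "top_key b' < top_key b" "top_key b < top_key b' + W"
    using q t key keyP' by auto
  show "the (b p0) \<in> gaps b' ?P" using step keyP by (simp add: gaps_def)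
  show "put_on_top b' ?P (the (b p0)) = b"
  proof
    fix p show "put_on_top b' ?P (the (b p0)) p = b p"
      using top_level_props(2)[OF b p0, of p] p0 Psub by (auto simp: put_on_top_def b'_def)
  qed
  have "linked b'" unfolding linked_def
  proof (intro ballI impI)
    fix p assume p: "p \<in> dom b'" "\<exists>q\<in>dom b'. key b' p < key b' q"
    then obtain q' where q': "q' \<in> dom b'" "key b' p < key b' q'" by blast
    hence "\<exists>q\<in>dom b. key b p < key b q" using key p dom by auto
    then obtain q where q: "q \<in> dom b" "key b p < key b q" "key b q < key b p + W"
      using blocksD(5)[OF b] p(1) dom unfolding linked_def by blast
    show "\<exists>q\<in>dom b'. key b' p < key b' q \<and> key b' q < key b' p + W"
    proof (cases "q \<in> ?P")
      case True
      hence "key b' q' < key b q" using below[OF q'(1)] keyP' by simp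
      thus ?thesis using q q' key p by (intro bexI[of _ q']) auto
    next
      case False
      thus ?thesis using q key p dom by (intro bexI[of _ q]) auto
    qed
  qed
  moreover have "0 \<in> ran b'"
  proof -
    obtain p where p: "b p = Some 0" using blocksD(4)[OF b] by (auto simp: ran_def)
    have "the (b t) = 0" if pP: "p \<in> ?P"
    proof (rule ccontr)
      assume "the (b t) \<noteq> 0"
      hence "D \<le> key b t" by (cases "the (b t)") (auto simp: key_def)
      moreover have "key b p < D" using p pP Psub r_less[of p] blocksD(1)[OF b] by (auto simp: key_def)
      ultimately show False using below[OF t(1)] key[OF t(1)] keyP'[OF pP] by simp
    qed
    hence "\<exists>s\<in>dom b'. the (b s) = 0"
    proof (cases "p \<in> ?P")
      case False
      thus ?thesis using p dom by (intro bexI[of _ p]) auto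
    qed (use t in blast)
    then obtain s where s: "s \<in> dom b'" "the (b s) = 0" by blast
    hence "b' s = Some 0" using dom by (auto simp: b'_def)
    thus ?thesis by (rule ranI)
  qed
  ultimately show "b' \<in> blocks" using dom blocksD(1)[OF b] by (auto simp: blocks_def)
qed

definition blocks_on :: "nat set \<Rightarrow> (nat \<rightharpoonup> nat) set" where
  "blocks_on B = {b \<in> blocks. dom b = B}"

text \<open>
  All labels of a single level have the same height, which the normalization makes \<open>0\<close>.
\<close>

lemma blocks_with_one_level:
  assumes "B \<subseteq> {1..n}"
  shows "{b \<in> blocks_on B. top_level b = B} =
           (if card B \<in> tie_sizes then {\<lambda>p. if p \<in> B then Some 0 else None} else {})"
    (is "?L = (if _ then {?z} else {})")
proof -
  have "b = ?z \<and> card B \<in> tie_sizes" if "b \<in> ?L" for b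
  proof
    have b: "b \<in> blocks" "dom b = B" "top_level b = B" using that by (auto simp: blocks_on_def)
    obtain q where q: "b q = Some 0" using blocksD(4)[OF b(1)] by (auto simp: ran_def)
    show "b = ?z"
    proof
      fix p show "b p = ?z p"
        using top_level_props(2)[OF b(1), of p q] q b by (cases "p \<in> B") auto
    qed
    show "card B \<in> tie_sizes" using top_level_props(1)[OF b(1)] b by simp
  qed
  moreover have "?z \<in> ?L" if c: "card B \<in> tie_sizes"
  proof -
    have ne: "B \<noteq> {}" using c tie_sizes_pos by auto
    then obtain p0 where p0: "p0 \<in> B" by blast
    have dom: "dom ?z = B" by (auto split: if_splits)
    have key: "key ?z p = r p0" if "p \<in> B" for p
    proof -
      have "r p = r p0" using tie[OF assms ne] c p0 that by blast
      thus ?thesis using that by (simp add: key_def)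
    qed
    have "key ?z ` dom ?z = {r p0}" using key p0 dom by auto
    hence "top_key ?z = r p0" by (simp add: top_key_def)
    hence "top_level ?z = B" using dom key by (auto simp: top_level_def)
    moreover have "linked ?z" using dom key by (auto simp: linked_def)
    moreover have "0 \<in> ran ?z" using p0 by (auto simp: ran_def)
    ultimately show ?thesis using dom assms by (auto simp: blocks_on_def blocks_def)
  qed
  ultimately show ?thesis by auto
qed

lemma bij_put_on_top:
  assumes B: "B \<subseteq> {1..n}"
  shows "bij_betw (\<lambda>(P, b, v). put_on_top b P v)
     (SIGMA P:{P. P \<subset> B \<and> card P \<in> tie_sizes}. SIGMA b:blocks_on (B - P). gaps b P)
     {b \<in> blocks_on B. top_level b \<noteq> B}" (is "bij_betw ?f ?X ?Y")
proof (rule bij_betw_byWitness[where f' =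
      "\<lambda>b. (top_level b, b |` (- top_level b), the (b (SOME p. p \<in> top_level b)))"])
  have some: "(SOME p. p \<in> top_level b) \<in> top_level b" if "b \<in> blocks" for b
    using top_level_nonempty[OF that] by (simp add: some_in_eq)
  have *: "?f x \<in> ?Y \<and> (\<lambda>b. (top_level b, b |` (- top_level b), the (b (SOME p. p \<in> top_level b)))) (?f x) = x"
    if x: "x \<in> ?X" for x
  proof -
    obtain P b v where xe: "x = (P, b, v)" by (cases x)
    have h: "P \<subset> B" "card P \<in> tie_sizes" "b \<in> blocks" "dom b = B - P" "v \<in> gaps b P"
      using x xe by (auto simp: blocks_on_def)
    let ?b = "put_on_top b P v"
    have e: "?b \<in> blocks" "dom ?b = dom b \<union> P" "top_level ?b = P"
      using put_on_top_in_blocks[of b P v] h B by auto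
    have "the (?b (SOME p. p \<in> P)) = v"
      using some[OF e(1)] e(3) by (simp add: put_on_top_def)
    moreover have "?b |` (- P) = b"
      using h(4) by (auto simp: put_on_top_def restrict_map_def fun_eq_iff domIff)
    ultimately show ?thesis using e h xe by (auto simp: blocks_on_def)
  qed
  show "\<forall>x\<in>?X. (\<lambda>b. (top_level b, b |` (- top_level b), the (b (SOME p. p \<in> top_level b)))) (?f x) = x"
    and "?f ` ?X \<subseteq> ?Y" using * by (blast, blast)
  have **: "(top_level b, b |` (- top_level b), the (b (SOME p. p \<in> top_level b))) \<in> ?X \<and>
     ?f (top_level b, b |` (- top_level b), the (b (SOME p. p \<in> top_level b))) = b" if "b \<in> ?Y" for b
  proof -
    have b: "b \<in> blocks" "dom b = B" "top_level b \<noteq> dom b" using that by (auto simp: blocks_on_def)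
    have "top_level b \<subset> B" using b by (auto simp: top_level_def)
    thus ?thesis using remove_top_level[OF b(1,3) some[OF b(1)]] b top_level_props(1)[OF b(1)]
      by (auto simp: blocks_on_def)
  qed
  show "\<forall>b\<in>?Y. ?f (top_level b, b |` (- top_level b), the (b (SOME p. p \<in> top_level b))) = b"
    and "(\<lambda>b. (top_level b, b |` (- top_level b), the (b (SOME p. p \<in> top_level b)))) ` ?Y \<subseteq> ?X"
    using ** by (blast, blast)
qed

text \<open>
  The exponential generating function of the sets of labels that can share a key.
\<close>

definition level_egf :: "real fps" where
  "level_egf = Abs_fps (\<lambda>k. if k \<in> tie_sizes then 1 / fact k else 0)"

text \<open>
  A block is a single level, or it arises by putting a top level on a smaller block in one of \<open>m\<close>
  ways. Hence the generating function \<open>C\<close> of blocks satisfies \<open>C = T + m T C\<close> with \<open>T\<close> that of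
  levels.
\<close>

lemma card_blocks_on:
  assumes "B \<subseteq> {1..n}"
  shows "finite (blocks_on B) \<and>
    real (card (blocks_on B)) = fact (card B) * chain_egf m level_egf $ card B"
  using finite_subset[OF assms finite_atLeastAtMost] assms
proof (induction B rule: finite_psubset_induct)
  case (psubset B)
  let ?C = "chain_egf m level_egf"
  let ?X = "\<lambda>P. SIGMA b:blocks_on (B - P). gaps b P"
  let ?L = "{P. P \<subset> B \<and> card P \<in> tie_sizes}"
  have T0: "level_egf $ 0 = 0" using tie_sizes_pos by (simp add: level_egf_def)
  have C: "?C = level_egf + of_nat m * (level_egf * ?C)" using chain_egf_iff[OF T0] by blast
  have IH: "finite (blocks_on (B - P))"
      "real (card (blocks_on (B - P))) = fact (card (B - P)) * ?C $ card (B - P)"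
    if "P \<in> ?L" for P
  proof -
    have "P \<noteq> {}" using that tie_sizes_pos by auto
    hence "B - P \<subset> B" using that by blast
    thus "finite (blocks_on (B - P))"
      "real (card (blocks_on (B - P))) = fact (card (B - P)) * ?C $ card (B - P)"
      using psubset.IH[of "B - P"] psubset.prems by auto
  qed
  have gaps: "finite (gaps b P)" "card (gaps b P) = m" if "P \<in> ?L" "b \<in> blocks_on (B - P)" for b P
  proof -
    have "P \<subseteq> {1..n}" "P \<noteq> {}" using that psubset.prems tie_sizes_pos by auto
    thus "finite (gaps b P)" "card (gaps b P) = m"
      using finite_gaps card_gaps[of b P] that by (auto simp: blocks_on_def)
  qed
  have finL: "finite ?L" by (rule finite_subset[of _ "Pow B"]) (use psubset.hyps in auto)
  have finX: "finite (?X P)" if "P \<in> ?L" for P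
    using IH(1)[OF that] gaps(1)[OF that] by (rule finite_SigmaI)
  have split: "blocks_on B = {b \<in> blocks_on B. top_level b = B} \<union> {b \<in> blocks_on B. top_level b \<noteq> B}"
    by auto
  have bij: "bij_betw (\<lambda>(P, b, v). put_on_top b P v) (Sigma ?L ?X) {b \<in> blocks_on B. top_level b \<noteq> B}"
    by (rule bij_put_on_top[OF psubset.prems])
  have fin2: "finite {b \<in> blocks_on B. top_level b \<noteq> B}"
  proof -
    have "finite (Sigma ?L ?X)" by (rule finite_SigmaI[OF finL]) (rule finX)
    thus ?thesis by (simp only: bij_betw_finite[OF bij])
  qed
  have fin1: "finite {b \<in> blocks_on B. top_level b = B}"
    unfolding blocks_with_one_level[OF psubset.prems] by simp
  have cardX: "card (?X P) = card (blocks_on (B - P)) * m" if "P \<in> ?L" for P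
  proof -
    have "card (?X P) = (\<Sum>b\<in>blocks_on (B - P). card (gaps b P))"
      by (intro card_SigmaI ballI IH(1)[OF that] gaps(1)[OF that])
    also have "\<dots> = (\<Sum>b\<in>blocks_on (B - P). m)" by (intro sum.cong refl gaps(2)[OF that])
    finally show ?thesis by simp
  qed
  have "card (blocks_on B) = (if card B \<in> tie_sizes then 1 else 0) + card (Sigma ?L ?X)"
  proof -
    have "card (blocks_on B) =
        card {b \<in> blocks_on B. top_level b = B} + card {b \<in> blocks_on B. top_level b \<noteq> B}"
      by (subst split, rule card_Un_disjoint[OF fin1 fin2]) blast
    also have "card {b \<in> blocks_on B. top_level b = B} = (if card B \<in> tie_sizes then 1 else 0)"
      unfolding blocks_with_one_level[OF psubset.prems] by simp
    finally show ?thesis by (simp only: bij_betw_same_card[OF bij])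
  qed
  also have "card (Sigma ?L ?X) = (\<Sum>P\<in>?L. card (blocks_on (B - P)) * m)"
  proof -
    have "card (Sigma ?L ?X) = (\<Sum>P\<in>?L. card (?X P))"
      by (intro card_SigmaI finL ballI finX)
    also have "\<dots> = (\<Sum>P\<in>?L. card (blocks_on (B - P)) * m)" by (intro sum.cong refl cardX)
    finally show ?thesis .
  qed
  finally have "real (card (blocks_on B)) =
      (if card B \<in> tie_sizes then 1 else 0) + (\<Sum>P\<in>?L. real (card (blocks_on (B - P))) * real m)"
    by simp
  also have "(\<Sum>P\<in>?L. real (card (blocks_on (B - P))) * real m) =
      (\<Sum>P\<in>?L. real m * ((fact (card P) * level_egf $ card P) * (fact (card (B - P)) * ?C $ card (B - P))))"
    by (intro sum.cong refl) (auto simp: IH(2) level_egf_def)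
  also have "\<dots> = (\<Sum>P\<in>Pow B. real m * ((fact (card P) * level_egf $ card P) * (fact (card (B - P)) * ?C $ card (B - P))))"
    using psubset.hyps chain_egf_0[OF T0] by (intro sum.mono_neutral_left) (auto simp: level_egf_def)
  also have "\<dots> = real m * (fact (card B) * (level_egf * ?C) $ card B)"
    by (simp only: egf_mult[OF psubset.hyps(1)] sum_distrib_left)
  also have "(if card B \<in> tie_sizes then 1 else 0) + \<dots> =
      fact (card B) * (level_egf + of_nat m * (level_egf * ?C)) $ card B"
    by (simp add: level_egf_def algebra_simps flip: fps_of_nat)
  also have "\<dots> = fact (card B) * ?C $ card B" by (simp only: C[symmetric])
  finally have "real (card (blocks_on B)) = fact (card B) * ?C $ card B" .
  moreover have "finite (blocks_on B)" by (subst split) (rule finite_UnI[OF fin1 fin2])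
  ultimately show ?case by (rule conjI[rotated])
qed

end

section \<open>Flats as sets of blocks\<close>

lemma lookup_scaleR: "Poly_Mapping.lookup (c *\<^sub>R x) p = c * Poly_Mapping.lookup x p"
  for x :: "'a \<Rightarrow>\<^sub>0 real"
proof -
  have "{i. c *\<^sub>R Poly_Mapping.lookup x i \<noteq> 0} \<subseteq> {i. Poly_Mapping.lookup x i \<noteq> 0}" by auto
  hence "finite {i. c *\<^sub>R Poly_Mapping.lookup x i \<noteq> 0}"
    using finite_lookup finite_subset by blast
  thus ?thesis by (simp add: scaleR_poly_mapping_def)
qed

lemma Rspace_iff: "x \<in> Rspace n \<longleftrightarrow> (\<forall>p. p \<notin> {1..n} \<longrightarrow> Poly_Mapping.lookup x p = 0)"
  by (auto simp: Rspace_def in_keys_iff subset_iff)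

definition vec_of :: "nat set \<Rightarrow> (nat \<Rightarrow> real) \<Rightarrow> (nat \<Rightarrow>\<^sub>0 real)" where
  "vec_of C f = (\<Sum>p\<in>C. Poly_Mapping.single p (f p))"

lemma lookup_vec_of:
  "finite C \<Longrightarrow> Poly_Mapping.lookup (vec_of C f) p = (if p \<in> C then f p else 0)"
  by (simp add: vec_of_def lookup_sum lookup_single when_def if_distrib cong: if_cong)

abbreviation indicator_vec :: "nat set \<Rightarrow> (nat \<Rightarrow>\<^sub>0 real)" where
  "indicator_vec C \<equiv> vec_of C (\<lambda>_. 1)"

context key_arrangement
begin

definition arrangement :: "(nat \<Rightarrow>\<^sub>0 real) set set" where
  "arrangement = {hyperplane n i j a | i j a. 1 \<le> i \<and> i < j \<and> j \<le> n \<and>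
            \<bar>int D * a + int (r i) - int (r j)\<bar> < int W}"

definition near :: "(nat \<rightharpoonup> nat) \<Rightarrow> nat \<Rightarrow> nat \<Rightarrow> bool" where
  "near b p q \<longleftrightarrow> \<bar>int (key b p) - int (key b q)\<bar> < int W"

lemma near_sym: "near b p q \<longleftrightarrow> near b q p"
  by (simp add: near_def abs_minus_commute)

text \<open>
  The property of blocks that the geometry needs is that no splitting of the labels into two parts
  separates all pairs with nearby keys. For a linked block, let \<open>V\<close> be the part that does not contain
  a label \<open>t\<close> of the largest key; the label of \<open>V\<close> with the largest key in \<open>V\<close> is then near to \<open>t\<close>
  itself or to a label with the next larger key, which lies outside \<open>V\<close>.
\<close>

lemma linked_cut:
  assumes b: "linked b" "finite (dom b)" and U: "U \<subset> dom b" "U \<noteq> {}"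
  shows "\<exists>p\<in>U. \<exists>q\<in>dom b - U. near b p q"
proof -
  have "dom b \<noteq> {}" using U(1) by blast
  then obtain t where t: "t \<in> dom b" "key b t = top_key b"
    by (rule top_key_attained[OF b(2)])
  have cut: "\<exists>p\<in>V. \<exists>q\<in>dom b - V. near b p q"
    if V: "V \<subseteq> dom b" "V \<noteq> {}" "t \<notin> V" for V
  proof -
    have "finite V" using V(1) b(2) finite_subset by blast
    have "Max (key b ` V) \<in> key b ` V" using \<open>finite V\<close> V(2) by (intro Max_in) auto
    then obtain p where p0: "p \<in> V" "key b p = Max (key b ` V)" by (metis imageE)
    have p: "p \<in> V" "\<And>q. q \<in> V \<Longrightarrow> key b q \<le> key b p"
      using p0 \<open>finite V\<close> by simp_all
    show ?thesis
    proof (cases "key b p = key b t")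
      case True
      hence "near b p t" using W_pos by (simp add: near_def)
      thus ?thesis using p(1) t(1) V(3) by blast
    next
      case False
      have pb: "p \<in> dom b" using p(1) V(1) by blast
      hence "key b p < key b t" using False t(2) key_le_top_key[OF b(2) pb] by simp
      then obtain q where q: "q \<in> dom b" "key b p < key b q" "key b q < key b p + W"
        using b(1) pb t(1) unfolding linked_def by blast
      hence "q \<notin> V" using p(2)[of q] by auto
      moreover have "near b p q" using q by (simp add: near_def)
      ultimately show ?thesis using p(1) q(1) by blast
    qed
  qed
  show ?thesis
  proof (cases "t \<in> U")
    case True
    have "\<exists>p\<in>dom b - U. \<exists>q\<in>dom b - (dom b - U). near b p q"
      by (rule cut) (use U True in auto)
    thus ?thesis using near_sym by blast
  next
    case False
    thus ?thesis using cut[of U] U by blast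
  qed
qed

text \<open>
  Conversely, a label that is not on top is within \<open>W\<close> of a larger key, because the labels with
  keys up to its own must be joined to the rest by a near pair.
\<close>

lemma linkedI_cut:
  assumes "\<And>U. U \<subset> dom b \<Longrightarrow> U \<noteq> {} \<Longrightarrow> \<exists>p\<in>U. \<exists>q\<in>dom b - U. near b p q"
  shows "linked b"
  unfolding linked_def
proof (intro ballI impI)
  fix p assume p: "p \<in> dom b" "\<exists>q\<in>dom b. key b p < key b q"
  let ?U = "{s \<in> dom b. key b s \<le> key b p}"
  obtain q' where q': "q' \<in> dom b" "key b p < key b q'" using p(2) by blast
  have "q' \<notin> ?U" using q' by simp
  hence "?U \<subset> dom b" using q'(1) by blast
  moreover have "?U \<noteq> {}" using p(1) by blast
  ultimately obtain s q where sq: "s \<in> ?U" "q \<in> dom b - ?U" "near b s q"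
    using assms by meson
  hence "key b p < key b q" "key b s \<le> key b p" by auto
  moreover have "key b q < key b s + W" using sq(3) calculation by (simp add: near_def)
  ultimately show "\<exists>q\<in>dom b. key b p < key b q \<and> key b q < key b p + W"
    using sq(2) by (intro bexI[of _ q]) auto
qed

text \<open>
  The flat of a set of blocks fixes the relative positions of the coordinates inside each block and
  lets the blocks move freely against each other.
\<close>

definition flat_of :: "(nat \<rightharpoonup> nat) set \<Rightarrow> (nat \<Rightarrow>\<^sub>0 real) set" where
  "flat_of P = {x \<in> Rspace n. \<forall>b\<in>P. \<forall>p\<in>dom b. \<forall>q\<in>dom b.
     Poly_Mapping.lookup x p - Poly_Mapping.lookup x q = real (the (b p)) - real (the (b q))}"

abbreviation block_sets :: "nat \<Rightarrow> (nat \<rightharpoonup> nat) set set" where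
  "block_sets i \<equiv> assemblies dom blocks {1..n} i"

lemma block_setsD:
  assumes "P \<in> block_sets i"
  shows "b \<in> P \<Longrightarrow> b \<in> blocks" "finite P" "card P = i"
    and "b \<in> P \<Longrightarrow> c \<in> P \<Longrightarrow> p \<in> dom b \<Longrightarrow> p \<in> dom c \<Longrightarrow> b = c"
    and "p \<in> {1..n} \<Longrightarrow> \<exists>b\<in>P. p \<in> dom b"
proof -
  show "b \<in> P \<Longrightarrow> b \<in> blocks" "finite P" "card P = i" using assms by (auto simp: assemblies_def)
  show "b = c" if "b \<in> P" "c \<in> P" "p \<in> dom b" "p \<in> dom c"
    using assms that unfolding assemblies_def disjoint_family_on_def by blast
  have "\<Union>(dom ` P) = {1..n}" using assms by (simp add: assemblies_def)
  thus "p \<in> {1..n} \<Longrightarrow> \<exists>b\<in>P. p \<in> dom b" by blast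
qed

text \<open>
  The heights themselves are the coordinates of a point of the flat.
\<close>

lemma flat_of_nonempty:
  assumes P: "P \<in> block_sets i"
  obtains x where "x \<in> flat_of P"
proof -
  define \<beta> where "\<beta> p = (SOME b. b \<in> P \<and> p \<in> dom b)" for p
  have \<beta>: "\<beta> p = b" if "b \<in> P" "p \<in> dom b" for b p
  proof -
    have "\<beta> p \<in> P \<and> p \<in> dom (\<beta> p)"
      unfolding \<beta>_def by (rule someI[of "\<lambda>b. b \<in> P \<and> p \<in> dom b" b]) (rule conjI[OF that])
    thus ?thesis using block_setsD(4)[OF P, of "\<beta> p" b p] that by blast
  qed
  let ?x = "vec_of {1..n} (\<lambda>p. real (the (\<beta> p p)))"
  have "Poly_Mapping.lookup ?x p = real (the (b p))" if "b \<in> P" "p \<in> dom b" for b p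
  proof -
    have "p \<in> {1..n}" using blocksD(1)[OF block_setsD(1)[OF P that(1)]] that(2) by blast
    thus ?thesis using \<beta>[OF that] by (simp add: lookup_vec_of)
  qed
  hence "?x \<in> flat_of P" by (auto simp: flat_of_def Rspace_iff lookup_vec_of)
  thus ?thesis by (rule that)
qed

lemma flat_of_shift:
  assumes P: "P \<in> block_sets i" and x: "x \<in> flat_of P" and b: "b \<in> P"
  shows "x + indicator_vec (dom b) \<in> flat_of P"
proof -
  have b': "dom b \<subseteq> {1..n}" "finite (dom b)" using blocksD[OF block_setsD(1)[OF P b]] by auto
  have l: "Poly_Mapping.lookup (x + indicator_vec (dom b)) p =
      Poly_Mapping.lookup x p + (if p \<in> dom b then 1 else 0)" for p
    by (simp only: lookup_add lookup_vec_of[OF b'(2)])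
  show ?thesis unfolding flat_of_def
  proof (intro CollectI conjI ballI)
    have "x \<in> Rspace n" using x by (simp add: flat_of_def)
    thus "x + indicator_vec (dom b) \<in> Rspace n"
      using b'(1) unfolding Rspace_iff l by auto
    fix c p q assume c: "c \<in> P" "p \<in> dom c" "q \<in> dom c"
    have "p \<in> dom b \<longleftrightarrow> q \<in> dom b" using block_setsD(4)[OF P b c(1)] c by blast
    moreover have "Poly_Mapping.lookup x p - Poly_Mapping.lookup x q = real (the (c p)) - real (the (c q))"
      using x c unfolding flat_of_def by blast
    ultimately show "Poly_Mapping.lookup (x + indicator_vec (dom b)) p -
        Poly_Mapping.lookup (x + indicator_vec (dom b)) q = real (the (c p)) - real (the (c q))"
      unfolding l by simp
  qed
qed

lemma near_imp_hyperplane: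
  assumes P: "P \<in> block_sets i" and b: "b \<in> P" "p \<in> dom b" "q \<in> dom b" "p < q" "near b p q"
  shows "hyperplane n p q (int (the (b p)) - int (the (b q))) \<in> arrangement"
    and "flat_of P \<subseteq> hyperplane n p q (int (the (b p)) - int (the (b q)))"
proof -
  have pq: "p \<in> {1..n}" "q \<in> {1..n}" using blocksD(1)[OF block_setsD(1)[OF P b(1)]] b by auto
  have "int D * (int (the (b p)) - int (the (b q))) + int (r p) - int (r q)
      = int (key b p) - int (key b q)"
    by (simp add: key_def algebra_simps)
  thus "hyperplane n p q (int (the (b p)) - int (the (b q))) \<in> arrangement"
    using b(4,5) pq unfolding arrangement_def near_def by fastforce
  show "flat_of P \<subseteq> hyperplane n p q (int (the (b p)) - int (the (b q)))"
    using b by (auto simp: flat_of_def hyperplane_def)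
qed

text \<open>
  The hyperplanes given by near pairs inside the blocks cut out the flat: for a point \<open>x\<close> on all of
  them, the labels \<open>s\<close> of a block with a prescribed value of \<open>x\<^sub>s\<close> minus the height of \<open>s\<close> are
  joined to the remaining labels by no near pair, so by the cut property there are no remaining labels.
\<close>

lemma flat_of_in_flats:
  assumes P: "P \<in> block_sets i"
  shows "flat_of P \<in> flats n arrangement"
proof -
  let ?B = "{H \<in> arrangement. flat_of P \<subseteq> H}"
  have "flat_of P = Rspace n \<inter> \<Inter>?B"
  proof
    show "flat_of P \<subseteq> Rspace n \<inter> \<Inter>?B" by (auto simp: flat_of_def)
    show "Rspace n \<inter> \<Inter>?B \<subseteq> flat_of P"
    proof
      fix x assume x: "x \<in> Rspace n \<inter> \<Inter>?B"
      have const: "Poly_Mapping.lookup x p - real (the (b p)) = Poly_Mapping.lookup x q - real (the (b q))"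
        if b: "b \<in> P" "p \<in> dom b" "q \<in> dom b" for b p q
      proof -
        have bb: "linked b" "finite (dom b)" using blocksD[OF block_setsD(1)[OF P b(1)]] by auto
        have step: "Poly_Mapping.lookup x s - real (the (b s)) = Poly_Mapping.lookup x t - real (the (b t))"
          if st: "s \<in> dom b" "t \<in> dom b" "s < t" "near b s t" for s t
        proof -
          have "x \<in> hyperplane n s t (int (the (b s)) - int (the (b t)))"
            using x near_imp_hyperplane[OF P b(1) st] by blast
          thus ?thesis by (simp add: hyperplane_def)
        qed
        let ?U = "{s \<in> dom b. Poly_Mapping.lookup x s - real (the (b s)) = Poly_Mapping.lookup x p - real (the (b p))}"
        have "?U = dom b"
        proof (rule ccontr)
          assume "?U \<noteq> dom b"
          hence "?U \<subset> dom b" by blast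
          then obtain s t where st: "s \<in> ?U" "t \<in> dom b - ?U" "near b s t"
            using linked_cut[OF bb, of ?U] b(2) by blast
          hence "s \<noteq> t" by blast
          hence "s < t \<or> t < s" by linarith
          thus False using step[of s t] step[of t s] st near_sym by fastforce
        qed
        hence "q \<in> ?U" using b(3) by blast
        thus ?thesis by simp
      qed
      show "x \<in> flat_of P" unfolding flat_of_def
      proof (intro CollectI conjI ballI)
        show "x \<in> Rspace n" using x by (rule IntD1)
        fix b p q assume "b \<in> P" "p \<in> dom b" "q \<in> dom b"
        note const[OF this]
        thus "Poly_Mapping.lookup x p - Poly_Mapping.lookup x q =
          real (the (b p)) - real (the (b q))" by linarith
      qed
    qed
  qed
  moreover have "?B \<subseteq> arrangement" by blast
  ultimately have "\<exists>\<B>\<subseteq>arrangement. flat_of P = Rspace n \<inter> \<Inter>\<B>" by metis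
  moreover obtain x where "x \<in> flat_of P" by (rule flat_of_nonempty[OF P])
  ultimately show ?thesis unfolding flats_def by blast
qed

text \<open>
  The blocks can be read off from the flat: two labels lie in the same block precisely when the
  difference of their coordinates is constant on the flat, as a block can be moved on its own.
\<close>

lemma same_block_iff:
  assumes P: "P \<in> block_sets i" and b: "b \<in> P" "p \<in> dom b"
  shows "q \<in> dom b \<longleftrightarrow> (\<forall>x\<in>flat_of P. \<forall>y\<in>flat_of P.
    Poly_Mapping.lookup x p - Poly_Mapping.lookup x q = Poly_Mapping.lookup y p - Poly_Mapping.lookup y q)"
    (is "_ \<longleftrightarrow> ?R")
proof
  have diff: "Poly_Mapping.lookup x p - Poly_Mapping.lookup x q = real (the (b p)) - real (the (b q))"
    if "q \<in> dom b" "x \<in> flat_of P" for x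
    using that b unfolding flat_of_def by blast
  show "q \<in> dom b \<Longrightarrow> ?R" using diff by metis
  assume R: ?R
  obtain x where x: "x \<in> flat_of P" using flat_of_nonempty[OF P] .
  have "finite (dom b)" using blocksD[OF block_setsD(1)[OF P b(1)]] by auto
  hence "Poly_Mapping.lookup (x + indicator_vec (dom b)) s =
      Poly_Mapping.lookup x s + (if s \<in> dom b then 1 else 0)" for s
    by (simp only: lookup_add lookup_vec_of)
  thus "q \<in> dom b" using R[rule_format, OF x flat_of_shift[OF P x b(1)]] b(2)
    by (cases "q \<in> dom b") simp_all
qed

text \<open>
  The flat determines the label sets of the blocks and all height differences inside them, and the
  normalization of the lowest height then determines the blocks.
\<close>

lemma flat_of_subset_imp:
  assumes P: "P \<in> block_sets i" and Q: "Q \<in> block_sets j" and eq: "flat_of P = flat_of Q"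
  shows "P \<subseteq> Q"
proof
  fix b assume b: "b \<in> P"
  note bb = blocksD[OF block_setsD(1)[OF P b]]
  obtain p where p: "p \<in> dom b" using bb(3) by blast
  obtain c where c: "c \<in> Q" "p \<in> dom c" using block_setsD(5)[OF Q] p bb(1) by blast
  note cc = blocksD[OF block_setsD(1)[OF Q c(1)]]
  have dom: "dom b = dom c"
    using same_block_iff[OF P b p] same_block_iff[OF Q c] eq by blast
  obtain x where x: "x \<in> flat_of P" using flat_of_nonempty[OF P] .
  have diff: "real (the (b s)) - real (the (b t)) = real (the (c s)) - real (the (c t))"
    if "s \<in> dom b" "t \<in> dom b" for s t
  proof -
    have "x \<in> flat_of Q" using x eq by simp
    hence "Poly_Mapping.lookup x s - Poly_Mapping.lookup x t = real (the (c s)) - real (the (c t))"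
      using that dom c(1) unfolding flat_of_def by blast
    moreover have "Poly_Mapping.lookup x s - Poly_Mapping.lookup x t = real (the (b s)) - real (the (b t))"
      using x that b unfolding flat_of_def by blast
    ultimately show ?thesis by simp
  qed
  obtain s t where st: "b s = Some 0" "c t = Some 0" using bb(4) cc(4) by (auto simp: ran_def)
  have "the (b q) = the (c q)" if q: "q \<in> dom b" for q
  proof -
    have sb: "s \<in> dom b" "t \<in> dom b" using st dom by auto
    have "the (c s) = 0" using diff[OF sb] st by simp
    thus ?thesis using diff[OF q sb(1)] st by simp
  qed
  hence "b = c" using dom by (intro ext) (metis domIff option.expand)
  thus "b \<in> Q" using c(1) by simp
qed

text \<open>
  Every flat comes from a set of blocks. Its label classes collect the coordinates whose differences
  are a constant integer on the flat, and a point of the flat supplies the heights, counted from the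
  lowest one in each class. Each class is linked: if all near pairs of a class respected a splitting
  of it, then every defining hyperplane would be invariant under moving one part of the class, and
  the differences between the two parts would not be constant on the flat.
\<close>

lemma flat_is_flat_of:
  assumes F: "F \<in> flats n arrangement"
  obtains P where "P \<in> block_sets (card P)" "F = flat_of P"
proof -
  obtain \<B> where \<B>: "\<B> \<subseteq> arrangement" "F = Rspace n \<inter> \<Inter>\<B>" and Fne: "F \<noteq> {}"
    using F by (auto simp: flats_def)
  obtain x0 where x0: "x0 \<in> F" using Fne by blast
  define L where "L = Poly_Mapping.lookup x0"
  define R where "R = {(p, q). p \<in> {1..n} \<and> q \<in> {1..n} \<and>
     (\<exists>a::int. \<forall>x\<in>F. Poly_Mapping.lookup x p - Poly_Mapping.lookup x q = real_of_int a)}"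
  have "equiv {1..n} R"
  proof (rule equivI)
    show "R \<subseteq> {1..n} \<times> {1..n}" by (auto simp: R_def)
    show "refl_on {1..n} R" unfolding refl_on_def R_def by (auto intro: exI[of _ "0::int"])
    show "sym R"
    proof (rule symI)
      fix p q assume "(p, q) \<in> R"
      then obtain a :: int where "p \<in> {1..n}" "q \<in> {1..n}"
        "\<forall>x\<in>F. Poly_Mapping.lookup x p - Poly_Mapping.lookup x q = real_of_int a" by (auto simp: R_def)
      thus "(q, p) \<in> R" unfolding R_def by (auto intro!: exI[of _ "- a"])
    qed
    show "trans R"
    proof (rule transI)
      fix p q s assume "(p, q) \<in> R" "(q, s) \<in> R"
      then obtain a a' :: int where "p \<in> {1..n}" "s \<in> {1..n}"
        "\<forall>x\<in>F. Poly_Mapping.lookup x p - Poly_Mapping.lookup x q = real_of_int a"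
        "\<forall>x\<in>F. Poly_Mapping.lookup x q - Poly_Mapping.lookup x s = real_of_int a'" by (auto simp: R_def)
      hence "p \<in> {1..n}" "s \<in> {1..n}"
        "\<forall>x\<in>F. Poly_Mapping.lookup x p - Poly_Mapping.lookup x s = real_of_int (a + a')"
        by (blast, blast, smt (verit) of_int_add)
      thus "(p, s) \<in> R" unfolding R_def by blast
    qed
  qed
  note R_equiv = this
  define K where "K = {1..n} // R"
  have K_sub: "C \<subseteq> {1..n}" "C \<noteq> {}" "finite C" if "C \<in> K" for C
  proof -
    show s: "C \<subseteq> {1..n}" "C \<noteq> {}"
      using that R_equiv in_quotient_imp_subset in_quotient_imp_non_empty unfolding K_def by blast+
    show "finite C" using s finite_subset by blast
  qed
  have K_rel: "(p, q) \<in> R" if "C \<in> K" "p \<in> C" "q \<in> C" for C p q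
    using that R_equiv in_quotient_imp_in_rel unfolding K_def by (metis empty_subsetI insert_subset)
  have K_closed: "q \<in> C" if "C \<in> K" "p \<in> C" "(p, q) \<in> R" for C p q
    using that R_equiv in_quotient_imp_closed unfolding K_def by metis
  have K_const: "Poly_Mapping.lookup x p - Poly_Mapping.lookup x q = L p - L q"
    if "(p, q) \<in> R" "x \<in> F" for p q x
    using that x0 unfolding R_def L_def by force
  have \<B>_R: "(p, q) \<in> R" if "hyperplane n p q a \<in> \<B>" "p \<in> {1..n}" "q \<in> {1..n}" for p q a
    using that \<B>(2) unfolding R_def hyperplane_def by blast
  define base where "base C = Min (L ` C)" for C
  define blk where "blk C = (\<lambda>p. if p \<in> C then Some (nat \<lfloor>L p - base C\<rfloor>) else None)" for C
  have dom_blk: "dom (blk C) = C" for C by (auto simp: blk_def split: if_splits)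
  have base: "\<exists>p\<in>C. base C = L p" if "C \<in> K" for C
  proof -
    have "base C \<in> L ` C" unfolding base_def using K_sub[OF that] by (intro Min_in) auto
    thus ?thesis by blast
  qed
  have blk: "real (the (blk C p)) = L p - base C" if C: "C \<in> K" and p: "p \<in> C" for C p
  proof -
    obtain p0 where p0: "p0 \<in> C" "base C = L p0" using base[OF C] by blast
    have "base C \<le> L p" unfolding base_def using K_sub[OF C] p by (intro Min_le) auto
    moreover obtain a :: int where "L p - L p0 = real_of_int a"
      using K_rel[OF C p p0(1)] x0 unfolding R_def L_def by blast
    ultimately show ?thesis using p p0 by (simp add: blk_def)
  qed
  have blk_near: "near (blk C) p q \<longleftrightarrow> \<bar>int D * a + int (r p) - int (r q)\<bar> < int W"
    if "C \<in> K" "p \<in> C" "q \<in> C" "L p - L q = real_of_int a" for C p q a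
  proof -
    have "real (the (blk C p)) - real (the (blk C q)) = real_of_int a"
      using blk[OF that(1)] that by simp
    hence "a = int (the (blk C p)) - int (the (blk C q))" by linarith
    hence "int D * a = int D * int (the (blk C p)) - int D * int (the (blk C q))"
      by (simp only: right_diff_distrib)
    hence "int D * a + int (r p) - int (r q) = int (key (blk C) p) - int (key (blk C) q)"
      by (simp add: key_def)
    thus ?thesis by (simp add: near_def)
  qed
  have linked_blk: "linked (blk C)" if C: "C \<in> K" for C
  proof (rule linkedI_cut, rule ccontr)
    fix U assume U: "U \<subset> dom (blk C)" "U \<noteq> {}"
      and no: "\<not> (\<exists>p\<in>U. \<exists>q\<in>dom (blk C) - U. near (blk C) p q)"
    have UC: "U \<subset> C" using U by (simp add: dom_blk)
    have far: "\<not> near (blk C) p q \<and> \<not> near (blk C) q p" if "p \<in> U" "q \<in> C - U" for p q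
      using no that near_sym by (auto simp: dom_blk)
    have U1: "U \<subseteq> {1..n}" "finite U" using UC K_sub[OF C] finite_subset by blast+
    \<comment> \<open>Any nonzero displacement of \<open>U\<close> leads to the contradiction; the value 1/2 is arbitrary.\<close>
    let ?y = "x0 + (1/2) *\<^sub>R indicator_vec U"
    have y: "Poly_Mapping.lookup ?y p = L p + (if p \<in> U then 1/2 else 0)" for p
      using U1 by (simp add: lookup_add lookup_scaleR lookup_vec_of L_def)
    have "?y \<in> F" unfolding \<B>(2)
    proof
      have "x0 \<in> Rspace n" using x0 \<B>(2) by blast
      thus yR: "?y \<in> Rspace n" using U1 y by (auto simp: Rspace_iff L_def)
      show "?y \<in> \<Inter>\<B>"
      proof
        fix H assume H: "H \<in> \<B>"
        then obtain p q a where h: "H = hyperplane n p q a" "1 \<le> p" "p < q" "q \<le> n"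
          "\<bar>int D * a + int (r p) - int (r q)\<bar> < int W"
          using \<B>(1) unfolding arrangement_def by blast
        have pq: "(p, q) \<in> R" using \<B>_R[of p q a] H h by auto
        hence qp: "(q, p) \<in> R" using R_equiv by (meson equivE symE)
        have a: "L p - L q = real_of_int a"
          using H h(1) x0 \<B>(2) unfolding L_def hyperplane_def by blast
        have "p \<in> U \<longleftrightarrow> q \<in> U"
        proof (rule ccontr)
          assume ne: "\<not> (p \<in> U \<longleftrightarrow> q \<in> U)"
          hence "p \<in> C" "q \<in> C" using UC K_closed[OF C _ pq] K_closed[OF C _ qp] by blast+
          hence "near (blk C) p q" using blk_near[OF C _ _ a] h(5) by blast
          thus False using far \<open>p \<in> C\<close> \<open>q \<in> C\<close> ne by blast
        qed
        thus "?y \<in> H" using y yR a by (simp add: h(1) hyperplane_def)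
      qed
    qed
    obtain p q where "p \<in> U" "q \<in> C - U" using U(2) UC by blast
    thus False using K_const[OF K_rel[OF C, of p q] \<open>?y \<in> F\<close>] y UC by auto
  qed
  have blk_block: "blk C \<in> blocks" if C: "C \<in> K" for C
  proof -
    obtain p0 where p0: "p0 \<in> C" "base C = L p0" using base[OF C] by blast
    hence "blk C p0 = Some 0" by (simp add: blk_def)
    thus ?thesis using linked_blk[OF C] K_sub[OF C] by (auto simp: blocks_def dom_blk intro: ranI)
  qed
  define P where "P = blk ` K"
  have "finite P" unfolding P_def K_def
    using R_equiv by (intro finite_imageI finite_quotient) (auto simp: R_def)
  moreover have "disjoint_family_on dom P"
    using quotient_disj[OF R_equiv] unfolding disjoint_family_on_def P_def K_def by (auto simp: dom_blk)
  moreover have "\<Union>(dom ` P) = {1..n}"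
    using Union_quotient[OF R_equiv] unfolding P_def K_def by (simp add: image_image dom_blk)
  ultimately have "P \<in> block_sets (card P)"
    using blk_block unfolding assemblies_def P_def by blast
  moreover have "F = flat_of P"
  proof
    show "F \<subseteq> flat_of P"
    proof
      fix x assume x: "x \<in> F"
      have "Poly_Mapping.lookup x p - Poly_Mapping.lookup x q = real (the (blk C p)) - real (the (blk C q))"
        if "C \<in> K" "p \<in> C" "q \<in> C" for C p q
        using K_const[OF K_rel[OF that] x] blk[OF that(1)] that by simp
      moreover have "x \<in> Rspace n" using x \<B>(2) by blast
      ultimately show "x \<in> flat_of P" unfolding flat_of_def P_def by (simp add: dom_blk)
    qed
    show "flat_of P \<subseteq> F"
    proof
      fix x assume x: "x \<in> flat_of P"
      have "x \<in> H" if H: "H \<in> \<B>" for H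
      proof -
        obtain p q a where h: "H = hyperplane n p q a" "1 \<le> p" "p < q" "q \<le> n"
          using \<B>(1) H unfolding arrangement_def by blast
        have pq: "(p, q) \<in> R" using \<B>_R[of p q a] H h by auto
        have "p \<in> \<Union>K" using Union_quotient[OF R_equiv] h unfolding K_def by simp
        then obtain C where C: "C \<in> K" "p \<in> C" by blast
        have q: "q \<in> C" using K_closed[OF C pq] .
        have "Poly_Mapping.lookup x p - Poly_Mapping.lookup x q = real (the (blk C p)) - real (the (blk C q))"
          using x C q unfolding flat_of_def P_def by (auto simp: dom_blk)
        also have "\<dots> = L p - L q" using blk C q by simp
        also have "\<dots> = real_of_int a"
          using H h(1) x0 \<B>(2) unfolding L_def hyperplane_def by blast
        finally show ?thesis using x by (simp add: h(1) hyperplane_def flat_of_def)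
      qed
      moreover have "x \<in> Rspace n" using x by (simp add: flat_of_def)
      ultimately show "x \<in> F" using \<B>(2) by blast
    qed
  qed
  ultimately show ?thesis by (rule that)
qed

text \<open>
  The directions of the flat are the vectors that are constant on each block, and the indicator
  vectors of the blocks are a basis of this space.
\<close>

lemma flat_dim_flat_of:
  assumes P: "P \<in> block_sets i"
  shows "flat_dim (flat_of P) = i"
proof -
  let ?V = "{x - y | x y. x \<in> flat_of P \<and> y \<in> flat_of P}"
  let ?e = "\<lambda>b. indicator_vec (dom b)"
  have fin: "finite (dom b)" and ne: "dom b \<noteq> {}" and sub: "dom b \<subseteq> {1..n}" if "b \<in> P" for b
    using blocksD[OF block_setsD(1)[OF P that]] by auto
  have e: "Poly_Mapping.lookup (?e b) p = (if b = c then 1 else 0)"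
    if "b \<in> P" "c \<in> P" "p \<in> dom c" for b c p
    using block_setsD(4)[OF P that(1,2)] that fin by (auto simp: lookup_vec_of)
  have inj: "inj_on ?e P"
  proof (rule inj_onI)
    fix b c assume bc: "b \<in> P" "c \<in> P" "?e b = ?e c"
    obtain p where p: "p \<in> dom c" using ne[OF bc(2)] by blast
    have "Poly_Mapping.lookup (?e b) p = Poly_Mapping.lookup (?e c) p" using bc(3) by simp
    thus "b = c" using e[OF bc(1,2) p] e[OF bc(2,2) p] by (simp split: if_splits)
  qed
  have "dim ?V = i"
  proof (rule dim_unique)
    obtain x where x: "x \<in> flat_of P" using flat_of_nonempty[OF P] .
    show "?e ` P \<subseteq> ?V"
    proof
      fix v assume "v \<in> ?e ` P"
      then obtain b where b: "b \<in> P" "v = ?e b" by blast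
      have "v = (x + ?e b) - x" using b by simp
      thus "v \<in> ?V" using flat_of_shift[OF P x b(1)] x by blast
    qed
    show "?V \<subseteq> span (?e ` P)"
    proof
      fix v assume "v \<in> ?V"
      then obtain x y where v: "v = x - y" "x \<in> flat_of P" "y \<in> flat_of P" by blast
      have const: "Poly_Mapping.lookup v p = Poly_Mapping.lookup v q"
        if "b \<in> P" "p \<in> dom b" "q \<in> dom b" for b p q
        using v that by (force simp: flat_of_def lookup_minus)
      have out: "Poly_Mapping.lookup v p = 0" if "p \<notin> {1..n}" for p
        using v that unfolding flat_of_def Rspace_iff by (auto simp: lookup_minus)
      define s where "s b = (SOME p. p \<in> dom b)" for b :: "nat \<rightharpoonup> nat"
      have s: "s b \<in> dom b" if "b \<in> P" for b
        unfolding s_def using ne[OF that] by (simp add: some_in_eq)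
      have "v = (\<Sum>b\<in>P. Poly_Mapping.lookup v (s b) *\<^sub>R ?e b)" (is "_ = ?w")
      proof (rule poly_mapping_eqI)
        fix p
        have w: "Poly_Mapping.lookup ?w p = (\<Sum>b\<in>P. Poly_Mapping.lookup v (s b) * Poly_Mapping.lookup (?e b) p)"
          by (simp add: lookup_sum lookup_scaleR)
        show "Poly_Mapping.lookup v p = Poly_Mapping.lookup ?w p"
        proof (cases "p \<in> {1..n}")
          case True
          then obtain c where c: "c \<in> P" "p \<in> dom c" using block_setsD(5)[OF P] by blast
          have "Poly_Mapping.lookup ?w p = (\<Sum>b\<in>P. if b = c then Poly_Mapping.lookup v (s b) else 0)"
            unfolding w by (intro sum.cong refl) (simp add: e[OF _ c])
          also have "\<dots> = Poly_Mapping.lookup v (s c)"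
            using block_setsD(2)[OF P] c(1) by simp
          finally show ?thesis using const[OF c s[OF c(1)]] by simp
        next
          case False
          have "Poly_Mapping.lookup (?e b) p = 0" if "b \<in> P" for b
            using False sub[OF that] fin[OF that] by (auto simp: lookup_vec_of)
          thus ?thesis using out[OF False] w by simp
        qed
      qed
      thus "v \<in> span (?e ` P)" by (metis (no_types, lifting) imageI span_base span_scale span_sum)
    qed
    show "independent (?e ` P)"
    proof (rule independent_if_scalars_zero)
      show "finite (?e ` P)" using block_setsD(2)[OF P] by simp
      fix f :: "(nat \<Rightarrow>\<^sub>0 real) \<Rightarrow> real" and v
      assume z: "(\<Sum>v\<in>?e ` P. f v *\<^sub>R v) = 0" and v: "v \<in> ?e ` P"
      then obtain c where c: "c \<in> P" "v = ?e c" by blast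
      obtain p where p: "p \<in> dom c" using ne[OF c(1)] by blast
      have "0 = Poly_Mapping.lookup (\<Sum>v\<in>?e ` P. f v *\<^sub>R v) p" by (simp only: z lookup_zero)
      also have "\<dots> = (\<Sum>b\<in>P. f (?e b) * Poly_Mapping.lookup (?e b) p)"
        by (simp add: sum.reindex[OF inj] lookup_sum lookup_scaleR)
      also have "\<dots> = (\<Sum>b\<in>P. if b = c then f (?e b) else 0)"
        by (intro sum.cong refl) (simp add: e[OF _ c(1) p])
      also have "\<dots> = f v" using block_setsD(2)[OF P] c by simp
      finally show "f v = 0" by simp
    qed
    show "card (?e ` P) = i" using card_image[OF inj] block_setsD(3)[OF P] by simp
  qed
  thus ?thesis by (simp add: flat_dim_def)
qed

lemma card_flats_of_dim:
  "real (card (flats_of_dim n arrangement i)) = fact n / fact i * (chain_egf m level_egf ^ i) $ n"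
proof -
  have "bij_betw flat_of (block_sets i) (flats_of_dim n arrangement i)"
  proof (rule bij_betw_imageI)
    show "inj_on flat_of (block_sets i)"
      using flat_of_subset_imp by (intro inj_onI) blast
    show "flat_of ` block_sets i = flats_of_dim n arrangement i"
    proof
      show "flat_of ` block_sets i \<subseteq> flats_of_dim n arrangement i"
        using flat_of_in_flats flat_dim_flat_of by (auto simp: flats_of_dim_def)
      show "flats_of_dim n arrangement i \<subseteq> flat_of ` block_sets i"
      proof
        fix F assume F: "F \<in> flats_of_dim n arrangement i"
        then obtain P where P: "P \<in> block_sets (card P)" "F = flat_of P"
          using flat_is_flat_of by (auto simp: flats_of_dim_def)
        hence "card P = i" using F flat_dim_flat_of by (auto simp: flats_of_dim_def)
        thus "F \<in> flat_of ` block_sets i" using P by auto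
      qed
    qed
  qed
  hence "card (flats_of_dim n arrangement i) = card (block_sets i)"
    by (simp add: bij_betw_same_card)
  also have "real (card (block_sets i)) =
      fact (card {1..n}) / fact i * (chain_egf m level_egf ^ i) $ card {1..n}"
    by (rule exponential_formula)
       (use blocksD(3) card_blocks_on in \<open>auto simp: blocks_on_def\<close>)
  finally show ?thesis by simp
qed

end

section \<open>The extended Catalan and Shi arrangements\<close>

text \<open>
  Any nonempty set of labels can share a key.
\<close>

lemma catalan_key_arrangement: "key_arrangement n 1 (m + 1) m (\<lambda>_. 0) {1..}"
proof
  fix u :: nat
  have "{v. 1 * u + 0 < 1 * v + 0 \<and> 1 * v + 0 < 1 * u + 0 + (m + 1)} = {u<..u + m}" by auto
  thus "card {v. 1 * u + 0 < 1 * v + 0 \<and> 1 * v + 0 < 1 * u + 0 + (m + 1)} = m" by simp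
next
  fix P assume "P \<subseteq> {1..n}" "P \<noteq> {}"
  hence "card P \<noteq> 0" using finite_subset by (metis card_0_eq finite_atLeastAtMost)
  thus "(\<forall>p\<in>P. \<forall>q\<in>P. (0::nat) = 0) \<longleftrightarrow> card P \<in> {1..}" by simp
qed auto

text \<open>
  All keys are distinct, so the levels are single labels. As keys are ordered by height first and then
  by label, the \<open>m\<close> admissible heights for \<open>p\<close> start at the height of \<open>q\<close> if \<open>q < p\<close> and one
  above it if \<open>p < q\<close>.
\<close>

lemma shi_key_arrangement:
  assumes m: "m \<ge> 1"
  shows "key_arrangement n (n + 1) ((n + 1) * m) m (\<lambda>p. p) {1}"
proof
  fix p q u :: nat assume pq: "p \<in> {1..n}" "q \<in> {1..n}" "p \<noteq> q"
  let ?D = "n + 1"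
  have lt: "?D * v + s < ?D * w + t \<longleftrightarrow> v < w \<or> v = w \<and> s < t"
    if "s < ?D" "t < ?D" for s t v w
  proof (cases v w rule: linorder_cases)
    case less
    hence "?D * (v + 1) \<le> ?D * w" by (intro mult_le_mono2) simp
    thus ?thesis using less that by (simp add: algebra_simps)
  next
    case greater
    hence "?D * (w + 1) \<le> ?D * v" by (intro mult_le_mono2) simp
    thus ?thesis using greater that by (simp add: algebra_simps)
  qed simp
  have "{v. ?D * u + q < ?D * v + p \<and> ?D * v + p < ?D * u + q + ?D * m} =
        {v. (u < v \<or> u = v \<and> q < p) \<and> (v < u + m \<or> v = u + m \<and> p < q)}"
    using lt[of q p u] lt[of p q _ "u + m"] pq by (auto simp: algebra_simps)
  also have "\<dots> = (if q < p then {u..<u + m} else {u<..u + m})" using pq m by auto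
  finally show "card {v. ?D * u + q < ?D * v + p \<and> ?D * v + p < ?D * u + q + ?D * m} = m" by simp
next
  fix P :: "nat set" assume "P \<subseteq> {1..n}" "P \<noteq> {}"
  thus "(\<forall>p\<in>P. \<forall>q\<in>P. p = q) \<longleftrightarrow> card P \<in> {1}"
    by (metis card_1_singleton_iff is_singletonI' is_singleton_altdef insertI1 singletonD singleton_iff)
qed (use m in auto)

theorem theorem1p15:
  shows "(\<forall>m::nat. \<forall>i\<ge>1. \<forall>j\<ge>1.
            card (flats_of_dim j (ext_catalan m j) i)
              = mat_mul (mat_pow (mat_mul S_mat c_mat) m) S_mat i j)
       \<and> (\<forall>m::nat. m \<ge> 1 \<longrightarrow> (\<forall>i\<ge>1. \<forall>j\<ge>1.
            card (flats_of_dim j (ext_shi m j) i)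
              = mat_pow (mat_mul S_mat c_mat) m i j))"
proof (intro conjI allI impI)
  fix m i j :: nat assume i: "1 \<le> i"
  interpret key_arrangement j 1 "m + 1" m "\<lambda>_. 0" "{1..}" by (rule catalan_key_arrangement)
  have "arrangement = ext_catalan m j"
    unfolding arrangement_def ext_catalan_def by (intro Collect_cong ex_cong1 conj_cong refl) auto
  moreover have "level_egf = fps_exp 1 - 1"
    unfolding level_egf_def by (rule fps_ext) (auto simp: Suc_le_eq)
  ultimately have "real (card (flats_of_dim j (ext_catalan m j) i)) =
      fact j / fact i * (chain_egf m (fps_exp 1 - 1) ^ i) $ j"
    using card_flats_of_dim[of i] by simp
  also have "\<dots> = real (mat_mul (mat_pow (mat_mul S_mat c_mat) m) S_mat i j)"
    using iteration_matrix_Sc_power_S[of m] i by (simp add: iteration_matrix_def)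
  finally show "card (flats_of_dim j (ext_catalan m j) i) =
      mat_mul (mat_pow (mat_mul S_mat c_mat) m) S_mat i j" by simp
next
  fix m i j :: nat assume m: "1 \<le> m" and i: "1 \<le> i"
  interpret key_arrangement j "j + 1" "(j + 1) * m" m "\<lambda>p. p" "{1}"
    by (rule shi_key_arrangement[OF m])
  \<comment> \<open>The refinement by labels shifts the key by less than one unit \<open>j + 1\<close> of height, upwards for
    the larger label, which excludes \<open>a = - m\<close> and admits \<open>a = m\<close>.\<close>
  have range: "\<bar>int (j + 1) * a + int p - int q\<bar> < int ((j + 1) * m) \<longleftrightarrow> 1 - int m \<le> a \<and> a \<le> int m"
    if pq: "1 \<le> p" "p < q" "q \<le> j" for a p q
  proof -
    let ?D = "int (j + 1)"
    have d: "0 < int q - int p" "int q - int p < ?D" using pq by auto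
    consider "a \<le> - int m" | "1 - int m \<le> a" "a \<le> int m" | "int m + 1 \<le> a" by linarith
    thus ?thesis
    proof cases
      case 1
      hence "?D * a \<le> ?D * (- int m)" by (intro mult_left_mono) auto
      thus ?thesis using 1 d by (simp add: algebra_simps)
    next
      case 2
      hence "?D * (1 - int m) \<le> ?D * a" "?D * a \<le> ?D * int m" by (auto intro!: mult_left_mono)
      thus ?thesis using 2 d by (simp add: algebra_simps abs_less_iff)
    next
      case 3
      hence "?D * (int m + 1) \<le> ?D * a" by (intro mult_left_mono) auto
      thus ?thesis using 3 d by (simp add: algebra_simps)
    qed
  qed
  have "arrangement = ext_shi m j"
    unfolding arrangement_def ext_shi_def
    by (intro Collect_cong ex_cong1) (use range in blast)
  moreover have "level_egf = fps_X"
    unfolding level_egf_def by (rule fps_ext) auto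
  ultimately have "real (card (flats_of_dim j (ext_shi m j) i)) =
      fact j / fact i * (chain_egf m fps_X ^ i) $ j"
    using card_flats_of_dim[of i] by simp
  also have "\<dots> = real (mat_pow (mat_mul S_mat c_mat) m i j)"
    using iteration_matrix_Sc_power[of m] i by (simp add: iteration_matrix_def)
  finally show "card (flats_of_dim j (ext_shi m j) i) = mat_pow (mat_mul S_mat c_mat) m i j" by simp
qed

end
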